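(* Let $K$ be an algebraically closed field and let $A$ be a finite dimensional $K$-algebra such that $\dim_K(\mathrm{Ext}^1_A(S,S))=0$ for every simple $A$-module $S$ and $\dim_K(\mathrm{Ext}^1_A(S,T))\leq 1$ for all non-isomorphic simple $A$-modules $S$ and $T$. Then $\mathrm{HH}^1(A)$ is a strongly solvable Lie algebra. In particular, $\mathrm{HH}^1(A)$ is a solvable Lie algebra.
   Context: $\mathrm{HH}^1(A)=\mathrm{Der}_K(A)/\mathrm{Inn}(A)$ denotes the first Hochschild cohomology of $A$, with the Lie bracket induced by the commutator of derivations. A Lie algebra $\mathcal{L}$ is called strongly solvable if its derived subalgebra $\mathcal{L}^{(1)}=[\mathcal{L},\mathcal{L}]$ is nilpotent. Modules are right modules. *)

theory Defs
  imports "Jordan_Normal_Form.VS_Connect" "HOL-Algebra.AbelCoset"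
begin

text \<open>
  The ground field and the algebra are types; every structure with a genuine carrier (modules,
  Hom- and Ext-spaces, Lie algebras) is a record, where a \<open>K\<close>-vector space is a
  \<open>vectorspace class_ring V\<close>. The fields \<open>mult\<close> and \<open>one\<close> that the record type \<open>module\<close> inherits
  from rings carry no information and are left unspecified.
\<close>

section \<open>Finite dimensional algebras\<close>

text \<open>
  Algebras are associative and unital. The sort \<open>{ring, monoid_mult}\<close> is \<open>ring_1\<close> without
  \<open>0 \<noteq> 1\<close>, so that the zero algebra is included.
\<close>

locale fin_dim_algebra = vector_space scale
  for scale :: "'k::field \<Rightarrow> 'a::{ring,monoid_mult} \<Rightarrow> 'a" +
  assumes scale_mult_left: "scale c (x * y) = scale c x * y"
    and scale_mult_right: "scale c (x * y) = x * scale c y"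
    and finite_dimensional: "\<exists>B. finite B \<and> span B = UNIV"


section \<open>Right modules\<close>

text \<open>In a right module, \<open>a \<odot>\<^bsub>M\<^esub> m\<close> stands for \<open>m \<cdot> a\<close>.\<close>

locale right_module = abelian_group M
  for M :: "('a::{ring,monoid_mult}, 'm) module" (structure) +
  assumes smult_closed: "m \<in> carrier M \<Longrightarrow> a \<odot> m \<in> carrier M"
    and smult_add_left: "m \<in> carrier M \<Longrightarrow> (a + b) \<odot> m = a \<odot> m \<oplus> b \<odot> m"
    and smult_add_right:
      "m \<in> carrier M \<Longrightarrow> n \<in> carrier M \<Longrightarrow> a \<odot> (m \<oplus> n) = a \<odot> m \<oplus> a \<odot> n"
    and smult_mult: "m \<in> carrier M \<Longrightarrow> (a * b) \<odot> m = b \<odot> (a \<odot> m)"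
    and smult_one: "m \<in> carrier M \<Longrightarrow> 1 \<odot> m = m"

definition right_submodule :: "'m set \<Rightarrow> ('a::{ring,monoid_mult}, 'm) module \<Rightarrow> bool" where
  "right_submodule N M \<longleftrightarrow> N \<subseteq> carrier M \<and> \<zero>\<^bsub>M\<^esub> \<in> N \<and>
     (\<forall>x\<in>N. \<forall>y\<in>N. x \<oplus>\<^bsub>M\<^esub> y \<in> N) \<and> (\<forall>a. \<forall>x\<in>N. a \<odot>\<^bsub>M\<^esub> x \<in> N)"

definition simple_module :: "('a::{ring,monoid_mult}, 'm) module \<Rightarrow> bool" where
  "simple_module M \<longleftrightarrow> right_module M \<and> carrier M \<noteq> {\<zero>\<^bsub>M\<^esub>} \<and>
     (\<forall>N. right_submodule N M \<longrightarrow> N = {\<zero>\<^bsub>M\<^esub>} \<or> N = carrier M)"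

text \<open>The constant \<^const>\<open>LinearCombinations.module_hom\<close> uses nothing but the carrier of its ring argument, so it applies
  to right modules over a noncommutative ring.\<close>

abbreviation homs ::
  "('a::{ring,monoid_mult}, 'm) module \<Rightarrow> ('a, 'n) module \<Rightarrow> ('m \<Rightarrow> 'n) set" where
  "homs M N \<equiv> LinearCombinations.module_hom class_ring M N"

definition module_isomorphic ::
  "('a::{ring,monoid_mult}, 'm) module \<Rightarrow> ('a, 'n) module \<Rightarrow> bool" where
  "module_isomorphic M N \<longleftrightarrow> (\<exists>f \<in> homs M N. bij_betw f (carrier M) (carrier N))"

text \<open>Every simple right module \<open>M\<close> is cyclic, say \<open>M = m \<cdot> A\<close>, and \<open>x \<mapsto> {a. m \<cdot> a = x}\<close> identifies
  it with a module whose elements are the cosets of the annihilator of \<open>m\<close>. So quantifying over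
  simple modules with elements in \<open>'a set\<close> reaches all simple modules up to isomorphism.\<close>

lemma simple_module_representative:
  fixes M :: "('a::{ring,monoid_mult}, 'm) module"
  assumes "simple_module M"
  shows "\<exists>N :: ('a, 'a set) module. simple_module N \<and> module_isomorphic M N"
proof -
  from assms have M: "right_module M" and nz: "carrier M \<noteq> {\<zero>\<^bsub>M\<^esub>}"
    and simp: "\<And>N. right_submodule N M \<Longrightarrow> N = {\<zero>\<^bsub>M\<^esub>} \<or> N = carrier M"
    by (auto simp: simple_module_def)
  interpret M: right_module M by (rule M)
  obtain m where m: "m \<in> carrier M" "m \<noteq> \<zero>\<^bsub>M\<^esub>"
    using nz M.zero_closed by blast
  have zero_smult: "0 \<odot>\<^bsub>M\<^esub> m = \<zero>\<^bsub>M\<^esub>"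
    using M.smult_add_left[OF m(1), of 0 0] M.smult_closed[OF m(1), of 0]
    by (metis M.add.r_cancel_one' add.right_neutral)
  have "right_submodule (range (\<lambda>a. a \<odot>\<^bsub>M\<^esub> m)) M"
    unfolding right_submodule_def
    using m(1) zero_smult
    by (auto simp: M.smult_closed simp flip: M.smult_add_left M.smult_mult intro: range_eqI[OF sym])
  moreover have "m \<in> range (\<lambda>a. a \<odot>\<^bsub>M\<^esub> m)"
    using M.smult_one[OF m(1)] by (metis rangeI)
  ultimately have gen: "range (\<lambda>a. a \<odot>\<^bsub>M\<^esub> m) = carrier M"
    using simp m(2) by blast
  define g where "g x = {a. a \<odot>\<^bsub>M\<^esub> m = x}" for x
  define h where "h X = (THE x. x \<in> carrier M \<and> g x = X)" for X
  have g_inj: "x = y" if "x \<in> carrier M" "y \<in> carrier M" "g x = g y" for x y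
  proof -
    from that(1) gen obtain a where "a \<odot>\<^bsub>M\<^esub> m = x" by (metis rangeE)
    with that(3) show ?thesis unfolding g_def by blast
  qed
  have hg [simp]: "h (g x) = x" if "x \<in> carrier M" for x
    unfolding h_def by (rule the_equality) (use that g_inj in auto)
  define N :: "('a, 'a set) module" where "N =
    \<lparr>carrier = g ` carrier M, mult = undefined, one = undefined, zero = g \<zero>\<^bsub>M\<^esub>,
     add = (\<lambda>X Y. g (h X \<oplus>\<^bsub>M\<^esub> h Y)), smult = (\<lambda>a X. g (a \<odot>\<^bsub>M\<^esub> h X))\<rparr>"
  have N_sel [simp]: "carrier N = g ` carrier M" "\<zero>\<^bsub>N\<^esub> = g \<zero>\<^bsub>M\<^esub>"
    "X \<oplus>\<^bsub>N\<^esub> Y = g (h X \<oplus>\<^bsub>M\<^esub> h Y)" "a \<odot>\<^bsub>N\<^esub> X = g (a \<odot>\<^bsub>M\<^esub> h X)" for X Y a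
    by (simp_all add: N_def)
  have ab: "abelian_group N"
  proof (rule abelian_groupI)
    fix X assume "X \<in> carrier N"
    then obtain x where x: "x \<in> carrier M" "X = g x" by auto
    then show "\<exists>Y\<in>carrier N. Y \<oplus>\<^bsub>N\<^esub> X = \<zero>\<^bsub>N\<^esub>"
      by (auto intro!: bexI[of _ "\<ominus>\<^bsub>M\<^esub> x"] simp: M.l_neg)
  qed (auto simp: M.add.m_ac)
  have rm: "right_module N"
    by (intro right_module.intro right_module_axioms.intro ab)
      (auto simp: M.smult_closed M.smult_add_left M.smult_add_right M.smult_mult M.smult_one)
  have "simple_module N"
    unfolding simple_module_def
  proof (intro conjI allI impI rm)
    show "carrier N \<noteq> {\<zero>\<^bsub>N\<^esub>}"
      using m g_inj[OF m(1) M.zero_closed] by auto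
    fix U assume U: "right_submodule U N"
    then have sub: "U \<subseteq> g ` carrier M" by (simp add: right_submodule_def)
    have "right_submodule (h ` U) M"
      unfolding right_submodule_def
    proof (intro conjI ballI allI)
      show "h ` U \<subseteq> carrier M" using sub by auto
      show "\<zero>\<^bsub>M\<^esub> \<in> h ` U"
        using U by (auto simp: right_submodule_def intro!: image_eqI[of _ _ "g \<zero>\<^bsub>M\<^esub>"])
    next
      fix x y assume "x \<in> h ` U" "y \<in> h ` U"
      then obtain X Y where XY: "X \<in> U" "Y \<in> U" "x = h X" "y = h Y" by auto
      then have "g (h X \<oplus>\<^bsub>M\<^esub> h Y) \<in> U" using U by (auto simp: right_submodule_def)
      moreover have "h X \<in> carrier M" "h Y \<in> carrier M" using XY sub by auto
      ultimately show "x \<oplus>\<^bsub>M\<^esub> y \<in> h ` U"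
        using XY by (metis M.add.m_closed hg image_eqI)
    next
      fix a x assume "x \<in> h ` U"
      then obtain X where X: "X \<in> U" "x = h X" by auto
      then have "g (a \<odot>\<^bsub>M\<^esub> h X) \<in> U" using U by (auto simp: right_submodule_def)
      moreover have "h X \<in> carrier M" using X sub by auto
      ultimately show "a \<odot>\<^bsub>M\<^esub> x \<in> h ` U"
        using X by (metis M.smult_closed hg image_eqI)
    qed
    then have "h ` U = {\<zero>\<^bsub>M\<^esub>} \<or> h ` U = carrier M" by (rule simp)
    moreover have "U = g ` h ` U"
    proof -
      have "g (h X) = X" if "X \<in> U" for X using that sub by auto
      then show ?thesis by (force simp: image_image)
    qed
    ultimately show "U = {\<zero>\<^bsub>N\<^esub>} \<or> U = carrier N" by (metis N_sel(1,2) image_empty image_insert)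
  qed
  moreover have "g \<in> homs M N"
    by (auto simp: LinearCombinations.module_hom_def M.smult_closed)
  moreover have "bij_betw g (carrier M) (carrier N)"
    by (auto simp: bij_betw_def intro: inj_onI g_inj)
  ultimately show ?thesis unfolding module_isomorphic_def by blast
qed


section \<open>Ext\<close>

definition quotient_space :: "('k, 'v, 'x) module_scheme \<Rightarrow> 'v set \<Rightarrow> ('k, 'v set) module" where
  "quotient_space V W =
    \<lparr>carrier = a_rcosets\<^bsub>V\<^esub> W, mult = undefined, one = undefined,
     zero = W, add = (\<lambda>X Y. X <+>\<^bsub>V\<^esub> Y),
     smult = (\<lambda>c X. \<Union>x\<in>X. W +>\<^bsub>V\<^esub> (c \<odot>\<^bsub>V\<^esub> x))\<rparr>"

text \<open>The free right module on a set \<open>X\<close>: finitely supported functions \<open>X \<rightarrow> A\<close>.\<close>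

definition free_module :: "'x set \<Rightarrow> ('a::{ring,monoid_mult}, 'x \<Rightarrow> 'a) module" where
  "free_module X =
    \<lparr>carrier = {f. finite {x. f x \<noteq> 0} \<and> {x. f x \<noteq> 0} \<subseteq> X}, mult = undefined, one = undefined,
     zero = (\<lambda>x. 0), add = (\<lambda>f g x. f x + g x), smult = (\<lambda>a f x. f x * a)\<rparr>"

text \<open>The canonical epimorphism from the free module on the elements of \<open>M\<close> onto \<open>M\<close>, and its
  kernel.\<close>

definition free_cover :: "('a::{ring,monoid_mult}, 'm) module \<Rightarrow> ('m \<Rightarrow> 'a) \<Rightarrow> 'm" where
  "free_cover M f = (\<Oplus>\<^bsub>M\<^esub> x \<in> {x. f x \<noteq> 0}. f x \<odot>\<^bsub>M\<^esub> x)"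

definition syzygy :: "('a::{ring,monoid_mult}, 'm) module \<Rightarrow> ('a, 'm \<Rightarrow> 'a) module" where
  "syzygy M = (free_module (carrier M))
     \<lparr>carrier := {f \<in> carrier (free_module (carrier M)). free_cover M f = \<zero>\<^bsub>M\<^esub>}\<rparr>"

definition hom_space ::
  "('k \<Rightarrow> 'a::{ring,monoid_mult} \<Rightarrow> 'a) \<Rightarrow> ('a, 'm) module \<Rightarrow> ('a, 'n) module
    \<Rightarrow> ('k, 'm \<Rightarrow> 'n) module" where
  "hom_space scale M N =
    \<lparr>carrier = homs M N \<inter> extensional (carrier M), mult = undefined, one = undefined,
     zero = (\<lambda>x\<in>carrier M. \<zero>\<^bsub>N\<^esub>),
     add = (\<lambda>f g. \<lambda>x\<in>carrier M. f x \<oplus>\<^bsub>N\<^esub> g x),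
     smult = (\<lambda>c f. \<lambda>x\<in>carrier M. scale c 1 \<odot>\<^bsub>N\<^esub> f x)\<rparr>"

text \<open>
  For a projective presentation \<open>0 \<rightarrow> R \<rightarrow> P \<rightarrow> M \<rightarrow> 0\<close>, \<open>Ext\<^sup>1(M, N)\<close> is the cokernel of the
  restriction map \<open>Hom(P, N) \<rightarrow> Hom(R, N)\<close>; up to isomorphism it does not depend on the
  presentation. Here the canonical free presentation is taken, so \<open>P\<close> is the free module on the
  elements of \<open>M\<close> and \<open>R\<close> is \<open>syzygy M\<close>.
\<close>

definition Ext1 ::
  "('k \<Rightarrow> 'a::{ring,monoid_mult} \<Rightarrow> 'a) \<Rightarrow> ('a, 'm) module \<Rightarrow> ('a, 'n) module
    \<Rightarrow> ('k, (('m \<Rightarrow> 'a) \<Rightarrow> 'n) set) module" where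
  "Ext1 scale M N = quotient_space (hom_space scale (syzygy M) N)
     ((\<lambda>f. restrict f (carrier (syzygy M))) ` carrier (hom_space scale (free_module (carrier M)) N))"


section \<open>Lie algebras\<close>

record ('k, 'l) lie = "('k, 'l) module" +
  bracket :: "'l \<Rightarrow> 'l \<Rightarrow> 'l"

locale lie_algebra = vectorspace class_ring L
  for L :: "('k::field, 'l) lie" (structure) +
  assumes bracket_closed: "x \<in> carrier L \<Longrightarrow> y \<in> carrier L \<Longrightarrow> bracket L x y \<in> carrier L"
    and bracket_add_left: "x \<in> carrier L \<Longrightarrow> y \<in> carrier L \<Longrightarrow> z \<in> carrier L \<Longrightarrow>
      bracket L (x \<oplus> y) z = bracket L x z \<oplus> bracket L y z"
    and bracket_add_right: "x \<in> carrier L \<Longrightarrow> y \<in> carrier L \<Longrightarrow> z \<in> carrier L \<Longrightarrow>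
      bracket L x (y \<oplus> z) = bracket L x y \<oplus> bracket L x z"
    and bracket_smult_left: "x \<in> carrier L \<Longrightarrow> y \<in> carrier L \<Longrightarrow>
      bracket L (c \<odot> x) y = c \<odot> bracket L x y"
    and bracket_smult_right: "x \<in> carrier L \<Longrightarrow> y \<in> carrier L \<Longrightarrow>
      bracket L x (c \<odot> y) = c \<odot> bracket L x y"
    and bracket_self: "x \<in> carrier L \<Longrightarrow> bracket L x x = \<zero>"
    and jacobi: "x \<in> carrier L \<Longrightarrow> y \<in> carrier L \<Longrightarrow> z \<in> carrier L \<Longrightarrow>
      bracket L x (bracket L y z) \<oplus> bracket L y (bracket L z x) \<oplus> bracket L z (bracket L x y) = \<zero>"

definition lie_product :: "('k::field, 'l) lie \<Rightarrow> 'l set \<Rightarrow> 'l set \<Rightarrow> 'l set" where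
  "lie_product L U V =
     LinearCombinations.module.span class_ring L {bracket L u v | u v. u \<in> U \<and> v \<in> V}"

definition derived_subalgebra :: "('k::field, 'l) lie \<Rightarrow> ('k, 'l) lie" where
  "derived_subalgebra L = L\<lparr>carrier := lie_product L (carrier L) (carrier L)\<rparr>"

fun lower_central :: "('k::field, 'l) lie \<Rightarrow> nat \<Rightarrow> 'l set" where
  "lower_central L 0 = carrier L"
| "lower_central L (Suc n) = lie_product L (carrier L) (lower_central L n)"

fun derived_series :: "('k::field, 'l) lie \<Rightarrow> nat \<Rightarrow> 'l set" where
  "derived_series L 0 = carrier L"
| "derived_series L (Suc n) = lie_product L (derived_series L n) (derived_series L n)"

definition nilpotent_lie :: "('k::field, 'l) lie \<Rightarrow> bool" where
  "nilpotent_lie L \<longleftrightarrow> (\<exists>n. lower_central L n = {\<zero>\<^bsub>L\<^esub>})"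

definition solvable_lie :: "('k::field, 'l) lie \<Rightarrow> bool" where
  "solvable_lie L \<longleftrightarrow> (\<exists>n. derived_series L n = {\<zero>\<^bsub>L\<^esub>})"

definition strongly_solvable_lie :: "('k::field, 'l) lie \<Rightarrow> bool" where
  "strongly_solvable_lie L \<longleftrightarrow> nilpotent_lie (derived_subalgebra L)"

definition quotient_lie :: "('k, 'l) lie \<Rightarrow> 'l set \<Rightarrow> ('k, 'l set) lie" where
  "quotient_lie L I = (let Q = quotient_space L I in
    \<lparr>carrier = carrier Q, mult = undefined, one = undefined,
     zero = zero Q, add = add Q, smult = smult Q,
     bracket = (\<lambda>X Y. \<Union>x\<in>X. \<Union>y\<in>Y. I +>\<^bsub>L\<^esub> bracket L x y)\<rparr>)"


section \<open>The first Hochschild cohomology\<close>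

definition derivations :: "('k::field \<Rightarrow> 'a::{ring,monoid_mult} \<Rightarrow> 'a) \<Rightarrow> ('a \<Rightarrow> 'a) set" where
  "derivations scale =
     {D. Vector_Spaces.linear scale scale D \<and> (\<forall>x y. D (x * y) = D x * y + x * D y)}"

definition inner_derivations :: "('a::{ring,monoid_mult} \<Rightarrow> 'a) set" where
  "inner_derivations = range (\<lambda>a x. a * x - x * a)"

definition Der :: "('k::field \<Rightarrow> 'a::{ring,monoid_mult} \<Rightarrow> 'a) \<Rightarrow> ('k, 'a \<Rightarrow> 'a) lie" where
  "Der scale =
    \<lparr>carrier = derivations scale, mult = undefined, one = undefined,
     zero = (\<lambda>x. 0), add = (\<lambda>D E x. D x + E x), smult = (\<lambda>c D x. scale c (D x)),
     bracket = (\<lambda>D E x. D (E x) - E (D x))\<rparr>"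

definition HH1 :: "('k::field \<Rightarrow> 'a::{ring,monoid_mult} \<Rightarrow> 'a) \<Rightarrow> ('k, ('a \<Rightarrow> 'a) set) lie" where
  "HH1 scale = quotient_lie (Der scale) inner_derivations"

end

theory Submission
  imports Defs
begin

text \<open>
  Let \<open>J\<close> be the radical. Every derivation of \<open>A\<close> becomes inner modulo \<open>J\<close>: restricted to a maximal
  right ideal \<open>I\<close> it is a homomorphism \<open>I \<rightarrow> A/I\<close>, which is a left multiplication because
  \<open>Ext\<^sup>1(A/I, A/I) = 0\<close>, and by the density theorem the resulting endomorphisms of the simple
  modules are realised by one element of \<open>A\<close>. A derivation with values in \<open>J\<close> induces a bimodule
  endomorphism of \<open>J/J\<^sup>2\<close>. If \<open>e\<close> and \<open>f\<close> act on the simple modules \<open>S\<close> and \<open>T\<close> as projections of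
  rank one and annihilate the other simple modules, then the dimension of \<open>eJf\<close> modulo \<open>J\<^sup>2\<close> is at most
  that of \<open>Ext\<^sup>1(S, T)\<close>, hence at most \<open>1\<close>. As these pieces generate \<open>J/J\<^sup>2\<close>, its bimodule endomorphisms
  commute. So modulo inner derivations every commutator maps \<open>J\<^sup>i\<close> into \<open>J\<^bsup>i+1\<^esup>\<close> for all \<open>i\<close>,
  and the derivations that raise the \<open>J\<close>-adic degree form a nilpotent Lie algebra.
\<close>

section \<open>The radical\<close>

text \<open>The algebra need not be basic and no idempotents are lifted: \<open>e\<close> and
  \<open>f\<close> are idempotent only modulo \<open>J\<close>. This is harmless, because
  \<open>e * x * f\<close> is considered only for \<open>x\<close> in \<open>J\<close> and modulo
  \<open>J^2\<close>, where errors in \<open>J\<close> disappear. Rank one is essential: simple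
  modules may have dimension greater than one, and then a block of \<open>J/J^2\<close> can be
  larger than the Ext space, while the corner \<open>eJf\<close> is not. On a corner that is at most
  a line a bimodule endomorphism is a scalar, which is why the bound 1 makes endomorphisms commute.
  The vanishing of self-extensions enters twice: for the corners with equal simple modules, and to
  make derivations inner modulo \<open>J\<close>. Algebraic closure enters through Schur's lemma, so
  that density yields full matrix algebras and hence matrix units. Simple modules are treated as
  \<open>A/I\<close> with \<open>I\<close> a maximal right ideal and their homomorphisms as left
  multiplications, which turns most statements into membership in a right ideal.\<close>

definition pairwise_product :: "'a::times set \<Rightarrow> 'a set \<Rightarrow> 'a set" where
  "pairwise_product U V = {x * y | x y. x \<in> U \<and> y \<in> V}"

context fin_dim_algebra
begin

lemma finite_dimensional_ex: "\<exists>B. finite B \<and> independent B \<and> span B = UNIV"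
proof -
  obtain S where S: "finite S" "span S = UNIV"
    using finite_dimensional by blast
  obtain B where B: "B \<subseteq> S" "independent B" "S \<subseteq> span B"
    using maximal_independent_subset by blast
  have "span S \<subseteq> span B"
    using B(3) by (simp add: span_minimal)
  then show ?thesis
    using B S by (metis finite_subset top.extremum_uniqueI)
qed

text \<open>The locale \<open>finite_dimensional_vector_space\<close> has a basis as parameter; any
  choice serves.\<close>

definition fd_basis :: "'a set" where
  "fd_basis = (SOME B. finite B \<and> independent B \<and> span B = UNIV)"

sublocale finite_dimensional_vector_space scale fd_basis
  using someI_ex[OF finite_dimensional_ex] unfolding fd_basis_def[symmetric]
  by unfold_locales auto

lemma scale_eq_mult: "scale c x = x * scale c 1"
  using scale_mult_right[of c x 1] by simp

lemma scale_eq_mult': "scale c x = scale c 1 * x"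
  using scale_mult_left[of c 1 x] by simp

section \<open>Right ideals and maximal right ideals\<close>

definition right_ideal :: "'a set \<Rightarrow> bool" where
  "right_ideal I \<longleftrightarrow> subspace I \<and> (\<forall>x\<in>I. \<forall>a. x * a \<in> I)"

text \<open>Scalars act as multiplication by \<open>scale c 1\<close>, so closure under right
  multiplication contains closure under scaling.\<close>

lemma right_idealI:
  assumes "0 \<in> I" "\<And>x y. x \<in> I \<Longrightarrow> y \<in> I \<Longrightarrow> x + y \<in> I" "\<And>x a. x \<in> I \<Longrightarrow> x * a \<in> I"
  shows "right_ideal I"
  unfolding right_ideal_def subspace_def using assms by (metis scale_eq_mult)

lemma
  assumes "right_ideal I"
  shows right_ideal_subspace: "subspace I"
    and right_ideal_zero: "0 \<in> I"
    and right_ideal_add: "x \<in> I \<Longrightarrow> y \<in> I \<Longrightarrow> x + y \<in> I"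
    and right_ideal_diff: "x \<in> I \<Longrightarrow> y \<in> I \<Longrightarrow> x - y \<in> I"
    and right_ideal_neg: "x \<in> I \<Longrightarrow> - x \<in> I"
    and right_ideal_mult: "x \<in> I \<Longrightarrow> x * a \<in> I"
    and right_ideal_scale: "x \<in> I \<Longrightarrow> scale c x \<in> I"
    and right_ideal_sum: "(\<And>k. k \<in> A \<Longrightarrow> f k \<in> I) \<Longrightarrow> sum f A \<in> I"
  using assms unfolding right_ideal_def
  by (auto intro: subspace_0 subspace_add subspace_diff subspace_neg subspace_scale subspace_sum)

lemma right_ideal_diff_cong:
  assumes "right_ideal I" "x - y \<in> I" shows "x \<in> I \<longleftrightarrow> y \<in> I"
  using right_ideal_add[OF assms(1) assms(2), of y] right_ideal_diff[OF assms(1) _ assms(2), of x]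
  by auto

text \<open>The set is the annihilator of the element \<open>x + I\<close> of
  \<open>A/I\<close>.\<close>

lemma right_ideal_transporter:
  assumes "right_ideal I" shows "right_ideal {a. x * a \<in> I}"
  using right_ideal_mult[OF assms]
  by (auto intro!: right_idealI simp: distrib_left right_ideal_zero[OF assms] right_ideal_add[OF assms]
       simp flip: mult.assoc)

text \<open>The set is the preimage in \<open>A\<close> of the submodule \<open>(x + I) K\<close> of
  \<open>A/I\<close>.\<close>

lemma right_ideal_translate:
  assumes "right_ideal I" "right_ideal K" shows "right_ideal {x * k + i | k i. k \<in> K \<and> i \<in> I}"
proof (rule right_idealI)
  show "0 \<in> {x * k + i | k i. k \<in> K \<and> i \<in> I}"
    using right_ideal_zero[OF assms(1)] right_ideal_zero[OF assms(2)] by force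
next
  fix a b assume "a \<in> {x * k + i | k i. k \<in> K \<and> i \<in> I}" "b \<in> {x * k + i | k i. k \<in> K \<and> i \<in> I}"
  then obtain k i k' i' where *: "a = x * k + i" "b = x * k' + i'" "k \<in> K" "i \<in> I" "k' \<in> K" "i' \<in> I"
    by blast
  have "a + b = x * (k + k') + (i + i')"
    by (simp add: * algebra_simps)
  with * show "a + b \<in> {x * k + i | k i. k \<in> K \<and> i \<in> I}"
    using right_ideal_add[OF assms(1)] right_ideal_add[OF assms(2)] by blast
next
  fix a b assume "a \<in> {x * k + i | k i. k \<in> K \<and> i \<in> I}"
  then obtain k i where *: "a = x * k + i" "k \<in> K" "i \<in> I"
    by blast
  have "a * b = x * (k * b) + i * b"
    by (simp add: * algebra_simps)
  with * show "a * b \<in> {x * k + i | k i. k \<in> K \<and> i \<in> I}"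
    using right_ideal_mult[OF assms(1)] right_ideal_mult[OF assms(2)] by blast
qed

lemma right_ideal_one_iff: "right_ideal I \<Longrightarrow> 1 \<in> I \<longleftrightarrow> I = UNIV"
  using right_ideal_mult[of I 1] by auto

definition maximal_right_ideal :: "'a set \<Rightarrow> bool" where
  "maximal_right_ideal I \<longleftrightarrow> right_ideal I \<and> I \<noteq> UNIV \<and>
     (\<forall>K. right_ideal K \<longrightarrow> I \<subseteq> K \<longrightarrow> K = I \<or> K = UNIV)"

lemma
  assumes "maximal_right_ideal I"
  shows maximal_right_ideal: "right_ideal I"
    and maximal_one: "1 \<notin> I"
    and maximal_eq: "right_ideal K \<Longrightarrow> I \<subseteq> K \<Longrightarrow> 1 \<notin> K \<Longrightarrow> K = I"
  using assms right_ideal_one_iff unfolding maximal_right_ideal_def by auto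

text \<open>\<open>A/I\<close> is simple, so the nonzero element \<open>x + I\<close> generates it;
  \<open>b\<close> carries it back to the generator \<open>1 + I\<close>.\<close>

lemma maximal_right_ideal_inverse:
  assumes I: "maximal_right_ideal I" and x: "x \<notin> I"
  shows "\<exists>b. 1 - x * b \<in> I"
proof -
  note [simp] = maximal_right_ideal[OF I]
  define K where "K = {x * k + i | k i. k \<in> UNIV \<and> i \<in> I}"
  have "right_ideal K"
    unfolding K_def by (rule right_ideal_translate) (auto intro: right_idealI)
  moreover have "I \<subseteq> K"
    unfolding K_def by (intro subsetI CollectI exI[of _ "0::'a"] exI) simp
  moreover have "x \<in> K"
    unfolding K_def using right_ideal_zero[of I]
    by (intro CollectI exI[of _ "1::'a"] exI[of _ 0]) simp
  ultimately have "1 \<in> K"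
    using maximal_eq[OF I] x by metis
  then obtain k i where "1 = x * k + i" "i \<in> I" unfolding K_def by blast
  then show ?thesis
    by (metis add_diff_cancel_left')
qed

text \<open>Left multiplication by \<open>x\<close> identifies \<open>A\<close> modulo this
  annihilator with the simple module \<open>A/I\<close>.\<close>

lemma maximal_right_ideal_transporter:
  assumes I: "maximal_right_ideal I" and x: "x \<notin> I"
  shows "maximal_right_ideal {a. x * a \<in> I}"
proof -
  note [simp] = maximal_right_ideal[OF I]
  have "K = {a. x * a \<in> I} \<or> K = UNIV" if K: "right_ideal K" "{a. x * a \<in> I} \<subseteq> K" for K
  proof (rule disjCI)
    assume "K \<noteq> UNIV"
    show "K = {a. x * a \<in> I}"
    proof (rule ccontr)
      assume "K \<noteq> {a. x * a \<in> I}"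
      then obtain k where k: "k \<in> K" "x * k \<notin> I" using K by auto
      then obtain b where "1 - x * k * b \<in> I" using maximal_right_ideal_inverse[OF I] by blast
      \<comment> \<open>Multiplying on the right by \<open>x\<close> puts
        \<open>1 - k * b * x\<close> into the annihilator of \<open>x + I\<close>.\<close>
      then have "x - x * k * b * x \<in> I"
        using right_ideal_mult[of I _ x] by (force simp: left_diff_distrib)
      then have "1 - k * b * x \<in> K"
        using K(2) by (auto simp: right_diff_distrib mult.assoc)
      then have "1 \<in> K"
        using right_ideal_diff_cong[OF K(1)] right_ideal_mult[OF K(1) k(1)] by (metis mult.assoc)
      then show False
        using \<open>K \<noteq> UNIV\<close> right_ideal_one_iff[OF K(1)] by blast
    qed
  qed
  then show ?thesis
    unfolding maximal_right_ideal_def using x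
    by (auto intro!: right_ideal_transporter dest: eqset_imp_iff[of _ _ 1])
qed

section \<open>The Jacobson radical and its powers\<close>

definition radical :: "'a set" where
  "radical = \<Inter>{I. maximal_right_ideal I}"

lemma right_ideal_radical: "right_ideal radical"
  unfolding radical_def
  by (rule right_idealI) (auto dest: maximal_right_ideal intro: right_ideal_zero right_ideal_add right_ideal_mult)

text \<open>If \<open>x \<notin> I\<close>, then \<open>x * a \<in> I\<close> says that
  \<open>a\<close> lies in the annihilator of \<open>x + I\<close>, which is again maximal and so
  contains the radical.\<close>

lemma radical_mult_left: "a \<in> radical \<Longrightarrow> x * a \<in> radical"
  unfolding radical_def
proof (intro InterI)
  fix I assume a: "a \<in> \<Inter> {I. maximal_right_ideal I}" and "I \<in> {I. maximal_right_ideal I}"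
  then have I: "maximal_right_ideal I" by blast
  show "x * a \<in> I"
  proof (cases "x \<in> I")
    case True
    then show ?thesis using maximal_right_ideal[OF I] right_ideal_mult by blast
  next
    case False
    then show ?thesis using a maximal_right_ideal_transporter[OF I False] by blast
  qed
qed

lemma radical_subset: "maximal_right_ideal I \<Longrightarrow> radical \<subseteq> I"
  unfolding radical_def by blast

fun radical_power :: "nat \<Rightarrow> 'a set" where
  "radical_power 0 = UNIV"
| "radical_power (Suc n) = span (pairwise_product (radical_power n) radical)"

lemma subspace_radical_power: "subspace (radical_power n)"
  by (cases n) auto

lemma pairwise_productI: "x \<in> U \<Longrightarrow> y \<in> V \<Longrightarrow> x * y \<in> pairwise_product U V"
  unfolding pairwise_product_def by blast

lemma span_pairwise_product_subset:
  assumes "subspace W" "\<And>x y. x \<in> U \<Longrightarrow> y \<in> V \<Longrightarrow> x * y \<in> W"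
  shows "span (pairwise_product U V) \<subseteq> W"
  using assms by (intro span_minimal) (auto simp: pairwise_product_def)

lemma subspace_mult_right_vimage: "subspace W \<Longrightarrow> subspace {x. x * a \<in> W}"
  unfolding subspace_def by (auto simp: distrib_right simp flip: scale_mult_left)

lemma subspace_mult_left_vimage: "subspace W \<Longrightarrow> subspace {x. a * x \<in> W}"
  unfolding subspace_def by (auto simp: distrib_left simp flip: scale_mult_right)

lemma radical_power_mult_left: "x \<in> radical_power n \<Longrightarrow> a * x \<in> radical_power n"
proof (induction n arbitrary: x)
  case (Suc n)
  have "radical_power (Suc n) \<subseteq> {x. a * x \<in> radical_power (Suc n)}"
    unfolding radical_power.simps
    by (intro span_pairwise_product_subset subspace_mult_left_vimage subspace_span)
      (auto intro!: span_base pairwise_productI Suc.IH simp flip: mult.assoc)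
  with Suc.prems show ?case by blast
qed auto

lemma radical_power_mult_right: "x \<in> radical_power n \<Longrightarrow> x * a \<in> radical_power n"
proof (cases n)
  case (Suc m)
  assume "x \<in> radical_power n"
  moreover have "radical_power (Suc m) \<subseteq> {x. x * a \<in> radical_power (Suc m)}"
    unfolding radical_power.simps
    by (intro span_pairwise_product_subset subspace_mult_right_vimage subspace_span)
      (auto intro!: span_base pairwise_productI right_ideal_mult[OF right_ideal_radical] simp: mult.assoc)
  ultimately show ?thesis using Suc by blast
qed auto

lemma right_ideal_radical_power: "right_ideal (radical_power n)"
  unfolding right_ideal_def using subspace_radical_power radical_power_mult_right by blast

lemma radical_power_one: "radical_power (Suc 0) = radical"
proof
  show "radical_power (Suc 0) \<subseteq> radical"
    unfolding radical_power.simps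
    by (intro span_pairwise_product_subset right_ideal_subspace right_ideal_radical radical_mult_left)
  show "radical \<subseteq> radical_power (Suc 0)"
    using span_base[OF pairwise_productI[of 1 UNIV]] by force
qed

lemma radical_power_add:
  "x \<in> radical_power m \<Longrightarrow> y \<in> radical_power n \<Longrightarrow> x * y \<in> radical_power (m + n)"
proof (induction n arbitrary: y)
  case 0 then show ?case by (simp add: radical_power_mult_right)
next
  case (Suc n)
  have "radical_power (Suc n) \<subseteq> {y. x * y \<in> radical_power (m + Suc n)}"
    unfolding radical_power.simps add_Suc_right
    by (intro span_pairwise_product_subset subspace_mult_left_vimage subspace_span)
      (auto intro!: span_base pairwise_productI Suc.IH Suc.prems simp flip: mult.assoc)
  with Suc.prems show ?case by blast
qed

lemma radical_power_Suc_subset: "radical_power (Suc n) \<subseteq> radical_power n"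
  unfolding radical_power.simps
  by (intro span_pairwise_product_subset subspace_radical_power radical_power_mult_right)

lemma radical_power_antimono: "m \<le> n \<Longrightarrow> radical_power n \<subseteq> radical_power m"
  by (rule lift_Suc_antimono_le[of radical_power]) (use radical_power_Suc_subset in auto)

text \<open>Nakayama's lemma by dimension: a right ideal \<open>m\<close> of largest dimension
  properly inside the power \<open>N\<close> has simple quotient \<open>N/m\<close>, and
  \<open>J\<close> annihilates simple modules, so \<open>N J\<close> lies in
  \<open>m\<close>.\<close>

lemma radical_power_Suc_psubset:
  assumes "radical_power n \<noteq> {0}"
  shows "radical_power (Suc n) \<subset> radical_power n"
proof -
  let ?N = "radical_power n"
  let ?P = "\<lambda>N. right_ideal N \<and> N \<subset> ?N"
  have P0: "?P {0}"
    using assms right_ideal_zero[OF right_ideal_radical_power] by (auto intro: right_idealI)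
  define m where "m = (ARG_MAX dim N. ?P N)"
  have m: "?P m" "\<And>N. ?P N \<Longrightarrow> dim N \<le> dim m"
    using arg_max_nat_lemma[of ?P "{0}" dim, OF P0, of "Suc dimension"] dim_subset_UNIV
    unfolding m_def by (auto simp: less_Suc_eq_le)
  then have rm: "right_ideal m" by blast
  have "x * y \<in> m" if x: "x \<in> ?N" and y: "y \<in> radical" for x y
  proof (cases "x \<in> m")
    case True then show ?thesis using rm by (simp add: right_ideal_mult)
  next
    case False
    \<comment> \<open>The annihilator of \<open>x + m\<close> in \<open>N/m\<close>; simplicity of
      \<open>N/m\<close> appears as its maximality.\<close>
    let ?I = "{a. x * a \<in> m}"
    have "K = ?I \<or> K = UNIV" if K: "right_ideal K" "?I \<subseteq> K" for K
    proof (rule disjCI)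
      assume "K \<noteq> UNIV"
      let ?L = "{x * k + i | k i. k \<in> K \<and> i \<in> m}"
      have L: "right_ideal ?L" using right_ideal_translate rm K by blast
      have "?L \<subseteq> ?N"
        using x m(1) right_ideal_add[OF right_ideal_radical_power] right_ideal_mult[OF right_ideal_radical_power]
        by blast
      \<comment> \<open>Otherwise \<open>1 - k\<close> annihilates \<open>x + m\<close>, and
        \<open>1 = (1 - k) + k\<close> lies in \<open>K\<close>.\<close>
      moreover have "x \<notin> ?L"
      proof
        assume "x \<in> ?L"
        then obtain k i where "x = x * k + i" "k \<in> K" "i \<in> m" by blast
        then have "x * (1 - k) \<in> m" by (metis add_diff_cancel_left' mult.right_neutral right_diff_distrib)
        then have "1 - k \<in> K" using K by blast
        then have "1 \<in> K" using right_ideal_add[OF K(1) _ \<open>k \<in> K\<close>, of "1 - k"] by simp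
        then show False using \<open>K \<noteq> UNIV\<close> right_ideal_one_iff[OF K(1)] by blast
      qed
      ultimately have "?P ?L" using L x by blast
      then have "dim ?L \<le> dim m" using m(2) by blast
      moreover have "m \<subseteq> ?L"
        using right_ideal_zero[OF K(1)] by force
      ultimately have "?L = m"
        using subspace_dim_equal[OF right_ideal_subspace[OF rm] right_ideal_subspace[OF L]] by simp
      then have "K \<subseteq> ?I"
        using right_ideal_zero[OF rm] by force
      then show "K = ?I" using K by blast
    qed
    then have "maximal_right_ideal ?I"
      unfolding maximal_right_ideal_def using False right_ideal_transporter[OF rm]
      by (auto dest: eqset_imp_iff[of _ _ 1])
    then show ?thesis using radical_subset y by blast
  qed
  then have "radical_power (Suc n) \<subseteq> m"
    unfolding radical_power.simps
    by (intro span_pairwise_product_subset right_ideal_subspace[OF rm])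
  then show ?thesis using m(1) by blast
qed

text \<open>The dimensions of the powers would otherwise decrease strictly forever.\<close>

lemma radical_nilpotent: "\<exists>n. radical_power n = {0}"
proof (rule ccontr)
  assume "\<nexists>n. radical_power n = {0}"
  then have less: "dim (radical_power (Suc n)) < dim (radical_power n)" for n
    using radical_power_Suc_psubset[of n] subspace_radical_power
    by (intro dim_psubset) (metis span_eq_iff)
  have "dim (radical_power n) + n \<le> dim (radical_power 0)" for n
  proof (induction n)
    case (Suc n) then show ?case using less[of n] by linarith
  qed simp
  from this[of "Suc (dim (radical_power 0))"] show False by simp
qed

end

section \<open>Simple modules and density\<close>

context fin_dim_algebra
begin

text \<open>This is \<open>Hom(A/I, A/K) = 0\<close>: a homomorphism is left multiplication by some
  \<open>x\<close> with \<open>x I \<subseteq> K\<close>, and it is zero exactly if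
  \<open>x \<in> K\<close>.\<close>

definition hom_trivial :: "'a set \<Rightarrow> 'a set \<Rightarrow> bool" where
  "hom_trivial I K \<longleftrightarrow> (\<forall>x. (\<forall>a\<in>I. x * a \<in> K) \<longrightarrow> x \<in> K)"

text \<open>A nonzero homomorphism between simple modules is invertible; \<open>y\<close> represents
  the inverse of left multiplication by \<open>x\<close>.\<close>

lemma hom_trivial_sym:
  assumes I: "maximal_right_ideal I" and K: "maximal_right_ideal K" and triv: "hom_trivial I K"
  shows "hom_trivial K I"
  unfolding hom_trivial_def
proof (intro allI impI)
  fix x assume x: "\<forall>a\<in>K. x * a \<in> I"
  note rI = maximal_right_ideal[OF I]
  show "x \<in> I"
  proof (rule ccontr)
    assume nx: "x \<notin> I"
    have "{v. x * v \<in> I} = K"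
      by (rule maximal_eq[OF K right_ideal_transporter[OF rI]]) (use x nx in auto)
    then have eqK: "x * v \<in> I \<longleftrightarrow> v \<in> K" for v by blast
    obtain y where y: "1 - x * y \<in> I"
      using maximal_right_ideal_inverse[OF I nx] by blast
    have "y * i \<in> K" if "i \<in> I" for i
    proof -
      have "i - (1 - x * y) * i \<in> I"
        using right_ideal_diff[OF rI that right_ideal_mult[OF rI y]] .
      then show ?thesis by (simp add: algebra_simps flip: eqK)
    qed
    then have "y \<in> K" using triv unfolding hom_trivial_def by blast
    then have "x * y \<in> I" using eqK by blast
    then show False
      using right_ideal_diff_cong[OF rI y] maximal_one[OF I] by blast
  qed
qed

text \<open>The common annihilator of the modules \<open>A/I\<close> with \<open>I\<close> in
  \<open>R\<close>.\<close>

definition core :: "'a set set \<Rightarrow> 'a set" where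
  "core R = {a. \<forall>I\<in>R. \<forall>v. v * a \<in> I}"

lemma right_ideal_core: "(\<And>I. I \<in> R \<Longrightarrow> right_ideal I) \<Longrightarrow> right_ideal (core R)"
  unfolding core_def
  by (rule right_idealI)
    (auto simp: distrib_left right_ideal_zero right_ideal_add right_ideal_mult simp flip: mult.assoc)

text \<open>Among finite families of pairwise non-isomorphic simple modules, one with common
  annihilator of least dimension is taken. A maximal right ideal not containing this annihilator
  would yield a further simple module that lowers the dimension.\<close>

lemma simple_representatives:
  obtains R where "finite R" "\<And>I. I \<in> R \<Longrightarrow> maximal_right_ideal I"
    "\<And>I K. I \<in> R \<Longrightarrow> K \<in> R \<Longrightarrow> I \<noteq> K \<Longrightarrow> hom_trivial I K" "core R = radical"
proof -
  define P where "P R \<longleftrightarrow> finite R \<and> (\<forall>I\<in>R. maximal_right_ideal I) \<and>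
     (\<forall>I\<in>R. \<forall>K\<in>R. I \<noteq> K \<longrightarrow> hom_trivial I K)" for R
  have "P {}" by (simp add: P_def)
  then obtain R where R: "P R" "\<And>R'. P R' \<Longrightarrow> dim (core R) \<le> dim (core R')"
    using ex_has_least_nat[of P "{}" "\<lambda>R. dim (core R)"] by blast
  then have max: "I \<in> R \<Longrightarrow> maximal_right_ideal I" for I by (simp add: P_def)
  have "a \<in> I'" if a: "a \<in> core R" and I': "maximal_right_ideal I'" for a I'
  proof (rule ccontr)
    assume na: "a \<notin> I'"
    note rI' = maximal_right_ideal[OF I']
    have triv: "hom_trivial I I'" if "I \<in> R" for I
      unfolding hom_trivial_def
    proof (intro allI impI, rule ccontr)
      fix x assume x: "\<forall>i\<in>I. x * i \<in> I'" "x \<notin> I'"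
      obtain b where b: "1 - x * b \<in> I'"
        using maximal_right_ideal_inverse[OF I' x(2)] by blast
      \<comment> \<open>\<open>a\<close> annihilates \<open>A/I\<close>, so
        \<open>b * a \<in> I\<close>; as \<open>x * b\<close> is 1 modulo \<open>I'\<close>, this
        forces \<open>a \<in> I'\<close>.\<close>
      have "x * (b * a) \<in> I'"
        using x(1) a \<open>I \<in> R\<close> by (auto simp: core_def)
      with right_ideal_mult[OF rI' b, of a] have "(1 - x * b) * a + x * (b * a) \<in> I'"
        by (rule right_ideal_add[OF rI'])
      then show False using na by (simp add: algebra_simps)
    qed
    have "P (insert I' R)"
      using R(1) I' triv hom_trivial_sym[OF max I' triv] unfolding P_def by auto
    moreover have "dim (core (insert I' R)) < dim (core R)"
    proof (rule dim_psubset)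
      have "a \<notin> core (insert I' R)"
      proof
        assume "a \<in> core (insert I' R)"
        then have "1 * a \<in> I'" unfolding core_def by blast
        then show False using na by simp
      qed
      then have "core (insert I' R) \<subset> core R"
        using a by (auto simp: core_def)
      moreover have "subspace (core R)" "subspace (core (insert I' R))"
        using maximal_right_ideal max I' by (auto intro!: right_ideal_subspace right_ideal_core)
      ultimately show "span (core (insert I' R)) \<subset> span (core R)"
        by (simp only: span_eq_iff[THEN iffD2])
    qed
    ultimately show False using R(2) by (simp add: linorder_not_le[symmetric])
  qed
  then have "core R = radical"
  proof (intro equalityI subsetI)
    fix a assume "a \<in> radical"
    then show "a \<in> core R"
      using radical_mult_left radical_subset[OF max] unfolding core_def by blast
  qed (auto simp: radical_def)
  then show thesis using R(1) that[of R] unfolding P_def by auto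
qed

section \<open>Polynomials over the ground field evaluated in the algebra\<close>

definition poly_eval :: "'a \<Rightarrow> 'k poly \<Rightarrow> 'a" where
  "poly_eval x p = fold_coeffs (\<lambda>c r. scale c 1 + x * r) p 0"

lemma poly_eval_0 [simp]: "poly_eval x 0 = 0"
  by (simp add: poly_eval_def)

lemma poly_eval_pCons [simp]: "poly_eval x (pCons c p) = scale c 1 + x * poly_eval x p"
  by (cases "p = 0 \<and> c = 0") (auto simp: poly_eval_def fold_coeffs_pCons_coeff_not_0_eq fold_coeffs_pCons_not_0_0_eq)

lemma poly_eval_add [simp]: "poly_eval x (p + q) = poly_eval x p + poly_eval x q"
  by (induction p q rule: poly_induct2) (auto simp: algebra_simps)

lemma poly_eval_smult [simp]: "poly_eval x (Polynomial.smult c p) = scale c (poly_eval x p)"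
  by (induction p) (auto simp: scale_right_distrib scale_mult_right)

lemma poly_eval_linear_factor:
  "poly_eval x ([:-c, 1:] * q) = (x - scale c 1) * poly_eval x q"
proof -
  have "[:-c, 1:] * q = pCons 0 q + Polynomial.smult (- c) q" by simp
  then show ?thesis
    by (simp only: poly_eval_add poly_eval_pCons poly_eval_smult)
      (simp add: left_diff_distrib flip: scale_mult_left)
qed

lemma poly_eval_monom: "poly_eval x (monom c n) = scale c (x ^ n)"
  by (induction n) (auto simp: monom_0 monom_Suc scale_mult_right)

lemma poly_eval_sum: "poly_eval x (sum f A) = (\<Sum>i\<in>A. poly_eval x (f i))"
  by (induction A rule: infinite_finite_induct) auto

text \<open>The \<open>dimension + 1\<close> powers of \<open>x\<close> are too many to be
  independent. Coinciding powers form a case of their own, because dependence is a property of sets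
  and would not see the repetition.\<close>

lemma poly_eval_eq_zero_ex: "\<exists>p. p \<noteq> 0 \<and> poly_eval x p = 0"
proof (cases "inj_on (\<lambda>i. x ^ i) {..dimension}")
  case True
  let ?S = "(\<lambda>i. x ^ i) ` {..dimension}"
  have "card ?S > dim ?S"
    using dim_subset_UNIV[of ?S] by (simp add: card_image[OF True])
  then have "dependent ?S"
    by (intro dependent_biggerset_general) auto
  then obtain u where u: "\<exists>v\<in>?S. u v \<noteq> 0" "(\<Sum>v\<in>?S. scale (u v) v) = 0"
    using dependent_finite[of ?S] by auto
  define p where "p = (\<Sum>i\<le>dimension. monom (u (x ^ i)) i)"
  have "poly_eval x p = 0"
    using u(2) by (simp add: p_def poly_eval_sum poly_eval_monom sum.reindex[OF True])
  moreover obtain i where i: "i \<le> dimension" "u (x ^ i) \<noteq> 0"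
    using u(1) by auto
  have "coeff p i = u (x ^ i)"
    using i(1) by (simp add: p_def coeff_sum)
  then have "p \<noteq> 0" using i(2) by force
  ultimately show ?thesis by blast
next
  case False
  then obtain i j where ij: "i \<noteq> j" "x ^ i = x ^ j" by (auto simp: inj_on_def)
  define p :: "'k poly" where "p = monom 1 i + monom (- 1) j"
  have "poly_eval x p = 0"
    using ij(2) by (simp add: p_def poly_eval_monom)
  moreover have "coeff p i = 1" using ij(1) by (simp add: p_def)
  then have "p \<noteq> 0" by force
  ultimately show ?thesis by blast
qed

text \<open>\<open>B\<close> represents a basis of \<open>A/I\<close> containing the generator,
  obtained by extending a basis of \<open>I\<close> together with \<open>1\<close>. Independence
  modulo \<open>I\<close> is put in the form that contradicts the conclusion of
  \<open>density\<close>.\<close>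

lemma maximal_right_ideal_complement:
  assumes I: "maximal_right_ideal I"
  shows "\<exists>B. 1 \<in> B \<and> finite B \<and> (\<forall>v. \<exists>u\<in>span B. v - u \<in> I) \<and> (\<forall>b\<in>B. \<forall>u\<in>span (B - {b}). b - u \<notin> I)"
proof -
  note rI = maximal_right_ideal[OF I]
  obtain C where C: "C \<subseteq> I" "independent C" "span C = I"
    using basis_exists[of I] right_ideal_subspace[OF rI] span_subspace by metis
  have indep: "independent (insert 1 C)"
    using C maximal_one[OF I] by (intro independent_insertI) auto
  then obtain B' where B': "insert 1 C \<subseteq> B'" "independent B'" "UNIV \<subseteq> span B'"
    using maximal_independent_subset_extend[OF subset_UNIV indep] by metis
  define B where "B = B' - C"
  have eq: "B' = C \<union> B" using B' by (auto simp: B_def)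
  have "1 \<in> B"
    using B'(1) C(1) maximal_one[OF I] by (auto simp: B_def)
  moreover have "finite B"
    using finiteI_independent[OF B'(2)] by (simp add: B_def)
  moreover have "\<exists>u\<in>span B. v - u \<in> I" for v
  proof -
    have "v \<in> span (C \<union> B)" using B'(3) eq by auto
    then obtain c u where "v = c + u" "c \<in> I" "u \<in> span B"
      using C(3) by (auto simp: span_Un)
    then show ?thesis by (intro bexI[of _ u]) auto
  qed
  moreover have "b - u \<notin> I" if "b \<in> B" "u \<in> span (B - {b})" for b u
  proof
    assume "b - u \<in> I"
    then have "(b - u) + u \<in> span (C \<union> (B - {b}))"
      unfolding span_Un C(3) using that(2) by blast
    moreover have "C \<union> (B - {b}) = B' - {b}"
      using eq that(1) by (auto simp: B_def)
    ultimately show False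
      using B'(2) that(1) eq unfolding dependent_def by auto
  qed
  ultimately show ?thesis by blast
qed

end

section \<open>Schur's lemma and density over an algebraically closed field\<close>

locale fin_dim_algebra_alg_closed = fin_dim_algebra scale
  for scale :: "'k::alg_closed_field \<Rightarrow> 'a::{ring,monoid_mult} \<Rightarrow> 'a"
begin

text \<open>Left multiplication by \<open>x\<close> is an endomorphism of \<open>A/I\<close>. Let
  \<open>p\<close> be nonzero of least degree with \<open>p(x) \<in> I\<close>, and
  \<open>p = (X - c) q\<close>. Then \<open>q(x) \<notin> I\<close> generates \<open>A/I\<close> and
  is killed by \<open>x - c\<close>, so \<open>x - c\<close> acts as zero.\<close>

lemma schur:
  assumes I: "maximal_right_ideal I" and x: "\<And>a. a \<in> I \<Longrightarrow> x * a \<in> I"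
  shows "\<exists>c. x - scale c 1 \<in> I"
proof -
  note rI = maximal_right_ideal[OF I]
  let ?P = "\<lambda>p. p \<noteq> 0 \<and> poly_eval x p \<in> I"
  obtain p0 where "?P p0"
    using poly_eval_eq_zero_ex[of x] right_ideal_zero[OF rI] by metis
  then obtain p where p: "?P p" "\<And>q. ?P q \<Longrightarrow> degree p \<le> degree q"
    using ex_has_least_nat[of ?P p0 degree] by blast
  have "degree p > 0"
  proof (rule ccontr)
    assume "\<not> degree p > 0"
    then obtain c where c: "p = [:c:]" by (metis degree_eq_zeroE gr0I)
    then have "c \<noteq> 0" "scale c 1 \<in> I" using p(1) by auto
    then have "scale (inverse c) (scale c 1) \<in> I"
      using right_ideal_scale[OF rI] by blast
    then show False using \<open>c \<noteq> 0\<close> maximal_one[OF I] by simp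
  qed
  then obtain c where "poly p c = 0"
    using alg_closed_imp_poly_has_root by blast
  then obtain q where q: "p = [:-c, 1:] * q"
    by (metis dvdE poly_eq_0_iff_dvd)
  with p(1) have "q \<noteq> 0" by auto
  then have "degree p = Suc (degree q)"
    unfolding q by (subst degree_mult_eq) auto
  then have nq: "poly_eval x q \<notin> I"
    using p(2)[of q] \<open>q \<noteq> 0\<close> by auto
  let ?y = "x - scale c 1" and ?v = "poly_eval x q"
  have yI: "?y * a \<in> I" if "a \<in> I" for a
    using right_ideal_diff[OF rI x[OF that] right_ideal_scale[OF rI that, of c]]
    by (simp add: left_diff_distrib scale_eq_mult'[of c a])
  obtain b where b: "1 - ?v * b \<in> I"
    using maximal_right_ideal_inverse[OF I nq] by blast
  have "?y * ?v \<in> I"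
    using p(1) unfolding q poly_eval_linear_factor by blast
  then have "?y * ?v * b \<in> I" by (rule right_ideal_mult[OF rI])
  with yI[OF b] have "?y * (1 - ?v * b) + ?y * ?v * b \<in> I"
    by (rule right_ideal_add[OF rI])
  then have "?y \<in> I"
    by (simp add: right_diff_distrib mult.assoc)
  then show ?thesis by blast
qed

text \<open>Jacobson density in dual form, with \<open>P\<close> a finite set of vectors
  \<open>v\<close> in simple modules \<open>A/K\<close>. Removing one vector \<open>v\<close> of
  \<open>A/L\<close> leaves an annihilator \<open>N\<close>; unless \<open>v N = 0\<close>, the rule
  \<open>v * a \<mapsto> w * a\<close> on \<open>N\<close> defines a homomorphism
  \<open>A/L \<rightarrow> A/I\<close>, which is zero for \<open>L \<noteq> I\<close> and a scalar
  for \<open>L = I\<close>.\<close>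

lemma density:
  assumes max: "\<And>I. I \<in> R \<Longrightarrow> maximal_right_ideal I"
    and triv: "\<And>I K. I \<in> R \<Longrightarrow> K \<in> R \<Longrightarrow> I \<noteq> K \<Longrightarrow> hom_trivial I K"
    and "finite P" and "fst ` P \<subseteq> R" and I: "I \<in> R"
    and "\<And>a. (\<And>K v. (K, v) \<in> P \<Longrightarrow> v * a \<in> K) \<Longrightarrow> w * a \<in> I"
  shows "\<exists>u\<in>span {v. (I, v) \<in> P}. w - u \<in> I"
  using assms(3,4,6)
proof (induction P arbitrary: w)
  case empty
  from empty.prems(2)[of 1] show ?case by (auto intro: bexI[of _ 0])
next
  case (insert Lv P)
  obtain L v where Lv: "Lv = (L, v)" by force
  have L: "L \<in> R" and P: "fst ` P \<subseteq> R" using insert.prems(1) by (auto simp: Lv)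
  note rI = maximal_right_ideal[OF max[OF I]] and rL = maximal_right_ideal[OF max[OF L]]
  define N where "N = {a. \<forall>(K, v)\<in>P. v * a \<in> K}"
  have rK: "right_ideal K" if "(K, v) \<in> P" for K v
    using P that max maximal_right_ideal by force
  have N: "right_ideal N"
  proof (rule right_idealI)
    show "0 \<in> N"
      unfolding N_def using right_ideal_zero[OF rK] by auto
    show "a + b \<in> N" if "a \<in> N" "b \<in> N" for a b
      using that right_ideal_add[OF rK] unfolding N_def by (fastforce simp: distrib_left)
    show "a * b \<in> N" if "a \<in> N" for a b
      using that right_ideal_mult[OF rK] unfolding N_def by (fastforce simp flip: mult.assoc)
  qed
  have prem: "w * a \<in> I" if "a \<in> N" "v * a \<in> L" for a
    using that by (intro insert.prems(2)) (auto simp: N_def Lv)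
  have IH: "\<exists>u\<in>span {v. (I, v) \<in> P}. w' - u \<in> I" if "\<And>a. a \<in> N \<Longrightarrow> w' * a \<in> I" for w'
    using that by (intro insert.IH P) (auto simp: N_def)
  have mono: "span {v. (I, v) \<in> P} \<subseteq> span {v. (I, v) \<in> insert Lv P}"
    by (intro span_mono) auto
  show ?case
  proof (cases "\<forall>a\<in>N. v * a \<in> L")
    case True
    then show ?thesis using IH prem mono by blast
  next
    case False
    then obtain r where r: "r \<in> N" "v * r \<notin> L" by blast
    obtain b where b: "1 - v * r * b \<in> L"
      using maximal_right_ideal_inverse[OF max[OF L] r(2)] by blast
    \<comment> \<open>The factor \<open>b\<close> makes \<open>v * r0\<close> equal to 1 modulo
      \<open>L\<close>, so \<open>x = w * r0\<close> represents the image of the generator of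
      \<open>A/L\<close>.\<close>
    define r0 where "r0 = r * b"
    have r0: "r0 \<in> N" "1 - v * r0 \<in> L"
      using r(1) N b by (auto simp: r0_def right_ideal_mult mult.assoc)
    define x where "x = w * r0"
    have xL: "x * a \<in> I" if "a \<in> L" for a
    proof -
      have "a - (1 - v * r0) * a \<in> L"
        by (intro right_ideal_diff[OF rL] right_ideal_mult[OF rL] that r0)
      then have "w * (r0 * a) \<in> I"
        by (intro prem right_ideal_mult[OF N] r0) (simp add: algebra_simps)
      then show ?thesis by (simp add: x_def mult.assoc)
    qed
    have wx: "w * a - x * (v * a) \<in> I" if "a \<in> N" for a
    proof -
      have "(1 - v * r0) * (v * a) \<in> L" by (intro right_ideal_mult[OF rL] r0)
      then have "w * (a - r0 * (v * a)) \<in> I"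
        by (intro prem right_ideal_diff[OF N] right_ideal_mult[OF N] r0 that) (simp add: algebra_simps)
      then show ?thesis by (simp add: x_def algebra_simps)
    qed
    show ?thesis
    proof (cases "L = I")
      case False
      then have "x \<in> I" using triv[OF L I] xL unfolding hom_trivial_def by blast
      then have "w * a \<in> I" if "a \<in> N" for a
        using right_ideal_diff_cong[OF rI wx[OF that]] right_ideal_mult[OF rI] by blast
      then show ?thesis using IH mono by blast
    next
      case True
      obtain c where c: "x - scale c 1 \<in> I"
        using schur[OF max[OF I]] xL True by blast
      \<comment> \<open>After subtracting the scalar multiple of \<open>v\<close>, the induction
        hypothesis applies to the remaining vectors.\<close>
      have "(w - scale c v) * a \<in> I" if "a \<in> N" for a
        using right_ideal_add[OF rI wx[OF that] right_ideal_mult[OF rI c, of "v * a"]]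
        by (simp add: algebra_simps scale_eq_mult'[of c v])
      from IH[OF this] obtain u where u: "u \<in> span {v. (I, v) \<in> P}" "w - scale c v - u \<in> I" by blast
      have "scale c v + u \<in> span {v. (I, v) \<in> insert Lv P}"
        using u(1) mono True Lv by (intro span_add span_scale) (auto intro: span_base)
      with u(2) show ?thesis by (auto simp: diff_diff_add)
    qed
  qed
qed

end

text \<open>The modules \<open>A/I\<close> for \<open>I \<in> R\<close> represent the simple modules. The element \<open>unit I b\<close> acts on
  \<open>A/I\<close>, with respect to the basis \<open>B I\<close>, as the matrix unit that sends \<open>b\<close> to \<open>1\<close>; in particular
  \<open>unit I 1\<close> acts as a projection of rank one.\<close>

locale simple_frame = fin_dim_algebra_alg_closed scale
  for scale :: "'k::alg_closed_field \<Rightarrow> 'a::{ring,monoid_mult} \<Rightarrow> 'a" +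
  fixes R :: "'a set set" and B :: "'a set \<Rightarrow> 'a set" and unit :: "'a set \<Rightarrow> 'a \<Rightarrow> 'a"
  assumes finite_R: "finite R"
    and maximal_R: "I \<in> R \<Longrightarrow> maximal_right_ideal I"
    and hom_trivial_R: "I \<in> R \<Longrightarrow> K \<in> R \<Longrightarrow> I \<noteq> K \<Longrightarrow> hom_trivial I K"
    and core_R: "core R = radical"
    and one_B: "I \<in> R \<Longrightarrow> 1 \<in> B I"
    and finite_B: "I \<in> R \<Longrightarrow> finite (B I)"
    and span_B: "I \<in> R \<Longrightarrow> \<exists>u\<in>span (B I). v - u \<in> I"
    and unit_same: "I \<in> R \<Longrightarrow> b \<in> B I \<Longrightarrow> b * unit I b - 1 \<in> I"
    and unit_other: "I \<in> R \<Longrightarrow> b \<in> B I \<Longrightarrow> K \<in> R \<Longrightarrow> c \<in> B K \<Longrightarrow> (K, c) \<noteq> (I, b) \<Longrightarrow>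
      c * unit I b \<in> K"

text \<open>Density by contraposition: \<open>b\<close> is independent of the other basis vectors
  modulo \<open>I\<close>, so some \<open>a\<close> annihilates all the other basis vectors of all
  the modules but not \<open>b\<close>; a further factor \<open>d\<close> moves \<open>b * a\<close>
  to \<open>1\<close>.\<close>

lemma (in fin_dim_algebra_alg_closed) simple_frame_ex: "\<exists>R B unit. simple_frame scale R B unit"
proof -
  obtain R where R: "finite R" "\<And>I. I \<in> R \<Longrightarrow> maximal_right_ideal I"
    "\<And>I K. I \<in> R \<Longrightarrow> K \<in> R \<Longrightarrow> I \<noteq> K \<Longrightarrow> hom_trivial I K" "core R = radical"
    using simple_representatives by metis
  have "\<forall>I\<in>R. \<exists>B. 1 \<in> B \<and> finite B \<and> (\<forall>v. \<exists>u\<in>span B. v - u \<in> I) \<and> (\<forall>b\<in>B. \<forall>u\<in>span (B - {b}). b - u \<notin> I)"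
    using maximal_right_ideal_complement R(2) by blast
  then obtain B where B: "\<And>I. I \<in> R \<Longrightarrow> 1 \<in> B I" "\<And>I. I \<in> R \<Longrightarrow> finite (B I)"
    "\<And>I v. I \<in> R \<Longrightarrow> \<exists>u\<in>span (B I). v - u \<in> I"
    "\<And>I b u. I \<in> R \<Longrightarrow> b \<in> B I \<Longrightarrow> u \<in> span (B I - {b}) \<Longrightarrow> b - u \<notin> I"
    unfolding bchoice_iff by blast
  have "\<exists>a. b * a - 1 \<in> I \<and> (\<forall>K\<in>R. \<forall>c\<in>B K. (K, c) \<noteq> (I, b) \<longrightarrow> c * a \<in> K)"
    if Ib: "I \<in> R" "b \<in> B I" for I b
  proof -
    let ?P = "(SIGMA K:R. B K) - {(I, b)}"
    note rI = maximal_right_ideal[OF R(2)[OF Ib(1)]]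
    have "{v. (I, v) \<in> ?P} = B I - {b}" using Ib(1) by auto
    then have *: "\<not> (\<exists>u\<in>span {v. (I, v) \<in> ?P}. b - u \<in> I)" using B(4) Ib by auto
    have "\<exists>a. (\<forall>K v. (K, v) \<in> ?P \<longrightarrow> v * a \<in> K) \<and> b * a \<notin> I"
    proof (rule ccontr)
      assume none: "\<nexists>a. (\<forall>K v. (K, v) \<in> ?P \<longrightarrow> v * a \<in> K) \<and> b * a \<notin> I"
      have "\<exists>u\<in>span {v. (I, v) \<in> ?P}. b - u \<in> I"
      proof (rule density[of R ?P I b, OF R(2) R(3)])
        show "finite ?P" using R(1) B(2) by auto
        show "fst ` ?P \<subseteq> R" by auto
      qed (use Ib(1) none in blast)+
      with * show False by blast
    qed
    then obtain a where a: "\<And>K v. (K, v) \<in> ?P \<Longrightarrow> v * a \<in> K" "b * a \<notin> I" by blast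
    then obtain d where "1 - b * a * d \<in> I"
      using maximal_right_ideal_inverse[OF R(2)[OF Ib(1)]] by blast
    then have "b * (a * d) - 1 \<in> I"
      using right_ideal_neg[OF rI] by (force simp: mult.assoc)
    moreover have "c * (a * d) \<in> K" if "K \<in> R" "c \<in> B K" "(K, c) \<noteq> (I, b)" for K c
      using a(1)[of K c] that right_ideal_mult[OF maximal_right_ideal[OF R(2)[OF that(1)]], of "c * a" d]
      by (auto simp: mult.assoc)
    ultimately show ?thesis by blast
  qed
  then obtain u where "\<And>I b. I \<in> R \<Longrightarrow> b \<in> B I \<Longrightarrow>
      b * u I b - 1 \<in> I \<and> (\<forall>K\<in>R. \<forall>c\<in>B K. (K, c) \<noteq> (I, b) \<longrightarrow> c * u I b \<in> K)"
    by metis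
  then have "simple_frame scale R B u"
    using R B by unfold_locales auto
  then show ?thesis by blast
qed

section \<open>Calculus with matrix units modulo the radical\<close>

context simple_frame
begin

lemma right_ideal_R: "I \<in> R \<Longrightarrow> right_ideal I"
  by (intro maximal_right_ideal maximal_R)

lemma span_mult_mem:
  assumes I: "I \<in> R" and "\<And>b. b \<in> B I \<Longrightarrow> b * z \<in> I"
  shows "v * z \<in> I"
proof -
  obtain u where u: "u \<in> span (B I)" "v - u \<in> I" using span_B[OF I] by blast
  have "span (B I) \<subseteq> {u. u * z \<in> I}"
    using assms(2) right_ideal_subspace[OF right_ideal_R[OF I]]
    by (intro span_minimal subspace_mult_right_vimage) auto
  then have "u * z \<in> I" using u(1) by blast
  then have "(v - u) * z + u * z \<in> I"
    using right_ideal_add[OF right_ideal_R[OF I]] right_ideal_mult[OF right_ideal_R[OF I] u(2)] by blast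
  then show ?thesis by (simp add: algebra_simps)
qed

text \<open>Killing the chosen bases of all \<open>A/I\<close> means lying in their common
  annihilator, which is the radical by \<open>core_R\<close>.\<close>

lemma radicalI:
  assumes "\<And>I b. I \<in> R \<Longrightarrow> b \<in> B I \<Longrightarrow> b * z \<in> I"
  shows "z \<in> radical"
  using assms span_mult_mem[of _ z]
  unfolding core_R[symmetric] core_def by blast

lemma radicalD: "z \<in> radical \<Longrightarrow> I \<in> R \<Longrightarrow> z \<in> I"
  using radical_subset maximal_R by blast

text \<open>Arbitrary values on all basis vectors are realised by one element:
  \<open>unit K b\<close> sends \<open>b\<close> to \<open>1\<close>, and \<open>1\<close> is then
  sent to \<open>\<phi> K b\<close>.\<close>

lemma mult_unit_sum:
  assumes I: "I \<in> R" and c: "c \<in> B I"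
  shows "c * (\<Sum>K\<in>R. \<Sum>b\<in>B K. unit K b * \<phi> K b) - \<phi> I c \<in> I"
proof -
  note rI = right_ideal_R[OF I]
  have "(\<Sum>K\<in>R. \<Sum>b\<in>B K. c * unit K b * \<phi> K b - (if (K, b) = (I, c) then \<phi> I c else 0)) \<in> I"
  proof (intro right_ideal_sum[OF rI])
    fix K b assume "K \<in> R" "b \<in> B K"
    then show "c * unit K b * \<phi> K b - (if (K, b) = (I, c) then \<phi> I c else 0) \<in> I"
      using right_ideal_mult[OF rI unit_same[OF I c], of "\<phi> I c"]
        right_ideal_mult[OF rI unit_other[of K b I c]] I c
      by (auto simp: left_diff_distrib)
  qed
  also have "(\<Sum>K\<in>R. \<Sum>b\<in>B K. c * unit K b * \<phi> K b - (if (K, b) = (I, c) then \<phi> I c else 0)) =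
      c * (\<Sum>K\<in>R. \<Sum>b\<in>B K. unit K b * \<phi> K b) - (\<Sum>(K, b)\<in>Sigma R B. if (K, b) = (I, c) then \<phi> I c else 0)"
    by (subst sum.Sigma[symmetric])
      (auto simp: sum_subtractf sum_distrib_left mult.assoc finite_R finite_B)
  also have "(\<Sum>(K, b)\<in>Sigma R B. if (K, b) = (I, c) then \<phi> I c else 0) = \<phi> I c"
  proof -
    have "(\<Sum>(K, b)\<in>Sigma R B. if (K, b) = (I, c) then \<phi> I c else 0) =
        (\<Sum>p\<in>Sigma R B. if p = (I, c) then \<phi> I c else 0)"
      by (rule sum.cong) (auto split: if_splits)
    then show ?thesis
      using I c by (subst (asm) sum.delta) (auto simp: finite_R finite_B)
  qed
  finally show ?thesis .
qed

text \<open>Multiplication by \<open>unit I b\<close> kills every term of the relation except the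
  one at \<open>b\<close>.\<close>

lemma independent_B:
  assumes I: "I \<in> R" and "(\<Sum>b\<in>B I. scale (c b) b) \<in> I" and b: "b \<in> B I"
  shows "c b = 0"
proof (rule ccontr)
  assume nz: "c b \<noteq> 0"
  note rI = right_ideal_R[OF I]
  have "(\<Sum>b'\<in>B I. scale (c b') (b' * unit I b)) \<in> I"
    using right_ideal_mult[OF rI assms(2), of "unit I b"] by (simp add: sum_distrib_right scale_mult_left)
  moreover have "(\<Sum>b'\<in>B I - {b}. scale (c b') (b' * unit I b)) \<in> I"
    using I b by (intro right_ideal_sum[OF rI] right_ideal_scale[OF rI] unit_other) auto
  ultimately have "scale (c b) (b * unit I b) \<in> I"
    using right_ideal_diff[OF rI] by (fastforce simp: sum.remove[OF finite_B[OF I] b])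
  then have "scale (inverse (c b)) (scale (c b) (b * unit I b)) \<in> I"
    by (rule right_ideal_scale[OF rI])
  then have "b * unit I b \<in> I" using nz by simp
  then show False
    using right_ideal_diff_cong[OF rI unit_same[OF I b]] maximal_one[OF maximal_R[OF I]] by blast
qed

lemma coordinates_B:
  assumes I: "I \<in> R" shows "\<exists>c. v - (\<Sum>b\<in>B I. scale (c b) b) \<in> I"
  using span_B[OF I, of v] by (auto simp: span_finite[OF finite_B[OF I]])

end

section \<open>Derivations modulo inner derivations\<close>

context fin_dim_algebra
begin

lemma separating_functional:
  assumes W: "subspace W" and v: "v \<notin> W"
  shows "\<exists>\<psi>. Vector_Spaces.linear scale (*) \<psi> \<and> (\<forall>w\<in>W. \<psi> w = 0) \<and> \<psi> v = 1"
proof -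
  interpret vector_space_pair scale "(*) :: 'k \<Rightarrow> 'k \<Rightarrow> 'k"
    by unfold_locales (auto simp: algebra_simps)
  obtain C where C: "C \<subseteq> W" "independent C" "span C = W"
    using basis_exists[of W] span_subspace W by metis
  have "independent (insert v C)"
    using C v by (intro independent_insertI) auto
  then obtain \<psi> where \<psi>: "Vector_Spaces.linear scale (*) \<psi>" "\<forall>x\<in>insert v C. \<psi> x = (if x = v then 1 else 0)"
    using linear_independent_extend[of "insert v C" "\<lambda>x. if x = v then 1 else 0"] by blast
  have "\<psi> w = 0" if "w \<in> C" for w
    using \<psi>(2) that C(1) v by auto
  then have "\<forall>w\<in>span C. \<psi> w = 0"
    using linear_eq_0_on_span[OF \<psi>(1)] by blast
  with \<psi> C(3) show ?thesis by auto
qed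

lemma
  assumes "D \<in> derivations scale"
  shows derivation_add: "D (x + y) = D x + D y"
    and derivation_diff: "D (x - y) = D x - D y"
    and derivation_zero: "D 0 = 0"
    and derivation_scale: "D (scale c x) = scale c (D x)"
    and derivation_sum: "D (sum f A) = (\<Sum>i\<in>A. D (f i))"
    and derivation_mult: "D (x * y) = D x * y + x * D y"
proof -
  have l: "Vector_Spaces.linear scale scale D" and "D (x * y) = D x * y + x * D y"
    using assms unfolding derivations_def by auto
  then show "D (x * y) = D x * y + x * D y" by blast
  interpret l: Vector_Spaces.linear scale scale D by (rule l)
  show "D (x + y) = D x + D y" "D (x - y) = D x - D y" "D 0 = 0" "D (scale c x) = scale c (D x)"
    "D (sum f A) = (\<Sum>i\<in>A. D (f i))"
    by (fact l.add l.diff l.zero l.scale l.sum)+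
qed

lemma derivationI:
  assumes "\<And>x y. D (x + y) = D x + D y" "\<And>c x. D (scale c x) = scale c (D x)"
    "\<And>x y. D (x * y) = D x * y + x * D y"
  shows "D \<in> derivations scale"
  unfolding derivations_def using assms by (auto intro!: Vector_Spaces.linear.intro module_hom.intro
    module_hom_axioms.intro vector_space_axioms module_axioms)

lemma inner_derivation: "(\<lambda>x. a * x - x * a) \<in> derivations scale"
  by (rule derivationI)
    (simp_all add: algebra_simps scale_right_diff_distrib flip: scale_mult_left scale_mult_right)

lemma derivation_diff_mem:
  assumes "D \<in> derivations scale" "E \<in> derivations scale"
  shows "(\<lambda>x. D x - E x) \<in> derivations scale"
  by (rule derivationI)
    (auto simp: derivation_add[OF assms(1)] derivation_add[OF assms(2)] derivation_scale[OF assms(1)]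
      derivation_scale[OF assms(2)] derivation_mult[OF assms(1)] derivation_mult[OF assms(2)]
      scale_right_diff_distrib algebra_simps)

lemma derivation_bracket:
  assumes "D \<in> derivations scale" "E \<in> derivations scale"
  shows "(\<lambda>x. D (E x) - E (D x)) \<in> derivations scale"
  by (rule derivationI)
    (auto simp: derivation_add[OF assms(1)] derivation_add[OF assms(2)] derivation_scale[OF assms(1)]
      derivation_scale[OF assms(2)] derivation_mult[OF assms(1)] derivation_mult[OF assms(2)]
      scale_right_diff_distrib algebra_simps)

section \<open>Derivations that raise the radical filtration\<close>

definition filtered_derivations :: "nat \<Rightarrow> ('a \<Rightarrow> 'a) set" where
  "filtered_derivations k =
     {D \<in> derivations scale. \<forall>i. \<forall>x\<in>radical_power i. D x \<in> radical_power (i + k)}"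

lemma filtered_derivations_bracket:
  assumes D: "D \<in> filtered_derivations k" and E: "E \<in> filtered_derivations l"
  shows "(\<lambda>x. D (E x) - E (D x)) \<in> filtered_derivations (k + l)"
proof -
  have "D (E x) - E (D x) \<in> radical_power (i + (k + l))" if "x \<in> radical_power i" for i x
  proof -
    have "D (E x) \<in> radical_power ((i + l) + k)" "E (D x) \<in> radical_power ((i + k) + l)"
      using D E that unfolding filtered_derivations_def by blast+
    then show ?thesis
      by (intro subspace_diff subspace_radical_power) (simp_all add: ac_simps)
  qed
  then show ?thesis
    using derivation_bracket D E unfolding filtered_derivations_def by blast
qed

lemma filtered_derivations_antimono: "k \<le> l \<Longrightarrow> filtered_derivations l \<subseteq> filtered_derivations k"
  unfolding filtered_derivations_def using radical_power_antimono[of "i + k" "i + l" for i] by force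

text \<open>At \<open>i = 0\<close> the filtration condition says that all values lie in
  \<open>J^k\<close>, which is zero for a suitable \<open>k\<close>.\<close>

lemma filtered_derivations_trivial: "\<exists>k. filtered_derivations k \<subseteq> {\<lambda>x. 0}"
proof -
  obtain k where "radical_power k = {0}" using radical_nilpotent by blast
  then have "filtered_derivations k \<subseteq> {\<lambda>x. 0}"
    unfolding filtered_derivations_def by (auto simp: fun_eq_iff dest!: spec[of _ 0])
  then show ?thesis by blast
qed

abbreviation radical_square :: "'a set" where
  "radical_square \<equiv> radical_power (Suc (Suc 0))"

lemma radical_square_mult: "x \<in> radical \<Longrightarrow> y \<in> radical \<Longrightarrow> x * y \<in> radical_square"
  using radical_power_add[of x "Suc 0" y "Suc 0"] by (simp add: radical_power_one del: radical_power.simps)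

lemmas radical_square_rules =
  subspace_add[OF subspace_radical_power] subspace_diff[OF subspace_radical_power]
  subspace_scale[OF subspace_radical_power] subspace_sum[OF subspace_radical_power]
  radical_power_mult_left radical_power_mult_right radical_square_mult

text \<open>The powers of \<open>J\<close> are generated by products, so by the Leibniz rule the
  conditions on \<open>A\<close> and on \<open>J\<close> propagate to all of them.\<close>

lemma filtered_derivations_oneI:
  assumes M: "M \<in> derivations scale" and "\<And>x. M x \<in> radical"
    and "\<And>x. x \<in> radical \<Longrightarrow> M x \<in> radical_square"
  shows "M \<in> filtered_derivations 1"
proof -
  have "M x \<in> radical_power (i + 1)" if "x \<in> radical_power i" for i x
    using that
  proof (induction i arbitrary: x)
    case 0 then show ?case using assms(2) by (simp only: radical_power_one add_0 One_nat_def)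
  next
    case (Suc i)
    have "radical_power (Suc i) \<subseteq> {x. M x \<in> radical_power (Suc i + 1)}"
      unfolding radical_power.simps(2)[of i]
    proof (rule span_pairwise_product_subset)
      show "subspace {x. M x \<in> radical_power (Suc i + 1)}"
        using subspace_radical_power unfolding subspace_def
        by (auto simp: derivation_zero[OF M] derivation_add[OF M] derivation_scale[OF M] simp del: radical_power.simps)
    next
      fix x y assume x: "x \<in> radical_power i" and y: "y \<in> radical"
      have "M x * y \<in> radical_power (i + 1 + 1)"
        using radical_power_add[OF Suc.IH[OF x], of y 1] y by (simp add: radical_power_one del: radical_power.simps)
      moreover have "x * M y \<in> radical_power (i + Suc (Suc 0))"
        by (rule radical_power_add[OF x assms(3)[OF y]])
      ultimately show "x * y \<in> {x. M x \<in> radical_power (Suc i + 1)}"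
        using subspace_add[OF subspace_radical_power]
        by (simp add: derivation_mult[OF M] del: radical_power.simps)
    qed
    with Suc.prems show ?case by blast
  qed
  then show ?thesis using M unfolding filtered_derivations_def by blast
qed

text \<open>Both Leibniz terms of a product from \<open>J J\<close> stay in \<open>J J\<close>;
  hence such a derivation acts on \<open>J/J^2\<close>.\<close>

lemma derivation_radical_square:
  assumes D: "D \<in> derivations scale" "\<And>x. D x \<in> radical" and x: "x \<in> radical_square"
  shows "D x \<in> radical_square"
proof -
  have "radical_square \<subseteq> {x. D x \<in> radical_square}"
    unfolding radical_power.simps(2)[of "Suc 0"] radical_power_one
  proof (rule span_pairwise_product_subset)
    show "subspace {x. D x \<in> span (pairwise_product radical radical)}"
      using subspace_span unfolding subspace_def
      by (auto simp: derivation_zero[OF D(1)] derivation_add[OF D(1)] derivation_scale[OF D(1)])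
  next
    fix x y assume "x \<in> radical" "y \<in> radical"
    then show "x * y \<in> {x. D x \<in> span (pairwise_product radical radical)}"
      unfolding mem_Collect_eq derivation_mult[OF D(1)]
      by (intro span_add span_base pairwise_productI D(2))
  qed
  with x show ?thesis by blast
qed

end

text \<open>The presentation \<open>0 \<rightarrow> I \<rightarrow> A \<rightarrow> A/I \<rightarrow> 0\<close> identifies \<open>Ext\<^sup>1(A/I, A/K)\<close> with the homomorphisms
  \<open>I \<rightarrow> A/K\<close> modulo left multiplications. The assumptions express the bounds on its dimension in
  these terms; the homomorphisms are represented by maps \<open>A \<rightarrow> A\<close>.\<close>

locale simple_frame_ext = simple_frame scale R B unit
  for scale :: "'k::alg_closed_field \<Rightarrow> 'a::{ring,monoid_mult} \<Rightarrow> 'a" and R B unit +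
  assumes ext_self: "I \<in> R \<Longrightarrow> (\<And>x y. h (x + y) = h x + h y) \<Longrightarrow>
      (\<And>x a. x \<in> I \<Longrightarrow> h (x * a) - h x * a \<in> I) \<Longrightarrow> \<exists>t. \<forall>y\<in>I. h y - t * y \<in> I"
    and ext_distinct: "I \<in> R \<Longrightarrow> K \<in> R \<Longrightarrow> I \<noteq> K \<Longrightarrow>
      (\<And>x y. h (x + y) = h x + h y) \<Longrightarrow> (\<And>x y. h' (x + y) = h' x + h' y) \<Longrightarrow>
      (\<And>x a. x \<in> I \<Longrightarrow> h (x * a) - h x * a \<in> K) \<Longrightarrow> (\<And>x a. x \<in> I \<Longrightarrow> h' (x * a) - h' x * a \<in> K) \<Longrightarrow>
      \<exists>c d t. (c \<noteq> 0 \<or> d \<noteq> 0) \<and> (\<forall>y\<in>I. scale c (h y) + scale d (h' y) - t * y \<in> K)"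
begin

lemma derivation_inner_mod_radical:
  assumes D: "D \<in> derivations scale"
  shows "\<exists>s. \<forall>a. D a - (s * a - a * s) \<in> radical"
proof -
  have "\<forall>I\<in>R. \<exists>t. \<forall>y\<in>I. D y - t * y \<in> I"
    using derivation_add[OF D] right_ideal_mult[OF right_ideal_R]
    by (intro ballI ext_self) (auto simp: derivation_mult[OF D])
  then obtain t where t: "\<And>I y. I \<in> R \<Longrightarrow> y \<in> I \<Longrightarrow> D y - t I * y \<in> I" by metis
  \<comment> \<open>On \<open>I\<close> the derivation agrees with left multiplication by
    \<open>t I\<close> modulo \<open>I\<close>, so \<open>\<phi> I\<close> induces a linear
    endomorphism of \<open>A/I\<close>; the element \<open>s\<close> realises these for all
    \<open>I\<close> at once.\<close>
  define \<phi> where "\<phi> I v = t I * v - D v" for I v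
  define s where "s = (\<Sum>K\<in>R. \<Sum>b\<in>B K. unit K b * \<phi> K b)"
  have s: "v * s - \<phi> I v \<in> I" if I: "I \<in> R" for I v
  proof -
    note rI = right_ideal_R[OF I]
    obtain u where u: "u \<in> span (B I)" "v - u \<in> I" using span_B[OF I] by blast
    have "span (B I) \<subseteq> {v. v * s - \<phi> I v \<in> I}"
    proof (rule span_minimal)
      show "B I \<subseteq> {v. v * s - \<phi> I v \<in> I}"
        using mult_unit_sum[OF I] unfolding s_def by blast
      have "scale c v * s - \<phi> I (scale c v) = scale c (v * s - \<phi> I v)" for c v
        by (simp add: \<phi>_def derivation_scale[OF D] scale_right_diff_distrib
          flip: scale_mult_left scale_mult_right)
      moreover have "(v + w) * s - \<phi> I (v + w) = (v * s - \<phi> I v) + (w * s - \<phi> I w)" for v w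
        by (simp add: \<phi>_def derivation_add[OF D] algebra_simps)
      moreover have "\<phi> I 0 = 0"
        by (simp add: \<phi>_def derivation_zero[OF D])
      ultimately show "subspace {v. v * s - \<phi> I v \<in> I}"
        using right_ideal_zero[OF rI] right_ideal_add[OF rI] right_ideal_scale[OF rI]
        unfolding subspace_def by simp
    qed
    then have "u * s - \<phi> I u \<in> I" using u(1) by blast
    moreover have "(v - u) * s - \<phi> I (v - u) \<in> I"
      using right_ideal_add[OF rI right_ideal_mult[OF rI u(2)] t[OF I u(2)]]
      unfolding \<phi>_def by (simp add: algebra_simps)
    ultimately have "((v - u) * s - \<phi> I (v - u)) + (u * s - \<phi> I u) \<in> I"
      using right_ideal_add[OF rI] by blast
    then show ?thesis
      by (simp add: \<phi>_def derivation_diff[OF D] algebra_simps)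
  qed
  have "D a - (s * a - a * s) \<in> radical" for a
  proof (rule radicalI)
    fix I b assume I: "I \<in> R"
    note rI = right_ideal_R[OF I]
    \<comment> \<open>By the Leibniz rule
      \<open>\<phi> I (b * a) = \<phi> I b * a - b * D a\<close>, so this difference is
      \<open>b\<close> times the element to be placed in the radical.\<close>
    have "(b * a * s - \<phi> I (b * a)) - (b * s - \<phi> I b) * a \<in> I"
      by (intro right_ideal_diff[OF rI] right_ideal_mult[OF rI] s I)
    moreover have "(b * a * s - \<phi> I (b * a)) - (b * s - \<phi> I b) * a = b * (D a - (s * a - a * s))"
      by (simp add: \<phi>_def derivation_mult[OF D] algebra_simps)
    ultimately show "b * (D a - (s * a - a * s)) \<in> I" by simp
  qed
  then show ?thesis by blast
qed

text \<open>\<open>unit I 1\<close> kills every chosen basis vector except \<open>1\<close> in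
  \<open>A/I\<close>, which it fixes modulo \<open>I\<close> and which \<open>x\<close> then
  kills.\<close>

lemma unit_left_mult:
  assumes I: "I \<in> R" and x: "x \<in> I" shows "unit I 1 * x \<in> radical"
proof (rule radicalI)
  fix K b assume K: "K \<in> R" "b \<in> B K"
  note rK = right_ideal_R[OF K(1)]
  show "b * (unit I 1 * x) \<in> K"
  proof (cases "(K, b) = (I, 1)")
    case True
    have "(1 * unit I 1 - 1) * x + x \<in> I"
      by (intro right_ideal_add right_ideal_mult unit_same one_B right_ideal_R I x)
    with True show ?thesis by (simp add: algebra_simps)
  next
    case False
    then show ?thesis
      using right_ideal_mult[OF rK unit_other[OF I one_B[OF I] K False]] by (simp add: mult.assoc)
  qed
qed

text \<open>Two ways to read off the coordinate \<open>g b\<close>: a matrix unit applied to the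
  vector with coordinates \<open>g\<close>, and a combination of matrix units applied to a basis
  vector.\<close>

lemma unit_sum_coordinates:
  assumes I: "I \<in> R" and b: "b \<in> B I"
  shows "(\<Sum>c\<in>B I. scale (g c) (c * unit I b)) - scale (g b) 1 \<in> I"
    and "(\<Sum>c\<in>B I. scale (g c) (b * unit I c)) - scale (g b) 1 \<in> I"
proof -
  note rI = right_ideal_R[OF I]
  have *: "(\<Sum>c\<in>B I. scale (g c) (f c)) - scale (g b) 1 \<in> I"
    if "f b - 1 \<in> I" "\<And>c. c \<in> B I \<Longrightarrow> c \<noteq> b \<Longrightarrow> f c \<in> I" for f
  proof -
    have "scale (g b) (f b - 1) + (\<Sum>c\<in>B I - {b}. scale (g c) (f c)) \<in> I"
      using that by (intro right_ideal_add right_ideal_sum right_ideal_scale rI) auto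
    then show ?thesis
      by (simp add: sum.remove[OF finite_B[OF I] b] scale_right_diff_distrib algebra_simps)
  qed
  show "(\<Sum>c\<in>B I. scale (g c) (c * unit I b)) - scale (g b) 1 \<in> I"
    using I b by (intro * unit_same unit_other) auto
  show "(\<Sum>c\<in>B I. scale (g c) (b * unit I c)) - scale (g b) 1 \<in> I"
    using I b by (intro * unit_same unit_other) auto
qed

text \<open>If \<open>a\<close> has the matrix \<open>c\<close> on \<open>A/K\<close>, then
  \<open>a * unit K b\<close> and the sum both send each basis vector \<open>d\<close> to
  \<open>c d b\<close> times \<open>1\<close>, and both kill the other simple modules.\<close>

lemma mult_unit_expand:
  assumes K: "K \<in> R" and b: "b \<in> B K"
    and c: "\<And>d. d \<in> B K \<Longrightarrow> d * a - (\<Sum>b\<in>B K. scale (c d b) b) \<in> K"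
  shows "a * unit K b - (\<Sum>d\<in>B K. scale (c d b) (unit K d)) \<in> radical"
proof (rule radicalI)
  fix L d assume L: "L \<in> R" "d \<in> B L"
  note rL = right_ideal_R[OF L(1)]
  have eq: "d * (a * unit K b - (\<Sum>d\<in>B K. scale (c d b) (unit K d))) =
      d * a * unit K b - (\<Sum>e\<in>B K. scale (c e b) (d * unit K e))"
    by (simp add: right_diff_distrib sum_distrib_left scale_mult_right mult.assoc)
  show "d * (a * unit K b - (\<Sum>d\<in>B K. scale (c d b) (unit K d))) \<in> L"
  proof (cases "L = K")
    case False
    have uL: "e * unit K e' \<in> L" if "e' \<in> B K" "e \<in> B L" for e e'
      using unit_other[OF K that(1) L(1) that(2)] False by blast
    have "d * a * unit K b \<in> L"
      by (rule span_mult_mem[OF L(1) uL[OF b]])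
    moreover have "(\<Sum>e\<in>B K. scale (c e b) (d * unit K e)) \<in> L"
      by (intro right_ideal_sum[OF rL] right_ideal_scale[OF rL] uL L(2))
    ultimately show ?thesis unfolding eq by (intro right_ideal_diff[OF rL])
  next
    case True
    then have d: "d \<in> B K" using L by simp
    note rK = right_ideal_R[OF K]
    have 1: "(d * a - (\<Sum>e\<in>B K. scale (c d e) e)) * unit K b \<in> K"
      by (intro right_ideal_mult[OF rK] c d)
    have 2: "(\<Sum>e\<in>B K. scale (c d e) (e * unit K b)) - scale (c d b) 1 \<in> K"
      by (rule unit_sum_coordinates(1)[OF K b])
    have 3: "(\<Sum>e\<in>B K. scale (c e b) (d * unit K e)) - scale (c d b) 1 \<in> K"
      by (rule unit_sum_coordinates(2)[OF K d])
    show ?thesis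
      using right_ideal_diff[OF rK right_ideal_add[OF rK 1 2] 3] unfolding eq True
      by (simp add: left_diff_distrib sum_distrib_right scale_mult_left)
  qed
qed

text \<open>A functional \<open>\<psi>\<close> that vanishes on \<open>J\<^sup>2\<close> yields a homomorphism \<open>I \<rightarrow> A/K\<close>, that is, an
  extension of \<open>A/I\<close> by \<open>A/K\<close>.\<close>

definition radical_hom :: "'a set \<Rightarrow> 'a set \<Rightarrow> ('a \<Rightarrow> 'k) \<Rightarrow> 'a \<Rightarrow> 'a" where
  "radical_hom I K \<psi> z = (\<Sum>b\<in>B K. scale (\<psi> (unit I 1 * z * unit K b)) b)"

lemma radical_hom_add:
  assumes "Vector_Spaces.linear scale (*) \<psi>"
  shows "radical_hom I K \<psi> (x + y) = radical_hom I K \<psi> x + radical_hom I K \<psi> y"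
proof -
  interpret \<psi>: Vector_Spaces.linear scale "(*)" \<psi> by (rule assms)
  show ?thesis
    unfolding radical_hom_def
    by (simp add: distrib_left distrib_right \<psi>.add scale_left_distrib sum.distrib)
qed

text \<open>As \<open>x \<in> I\<close>, the product \<open>unit I 1 * x\<close> lies in
  \<open>J\<close>. The error in \<open>J\<close> left by \<open>mult_unit_expand\<close> is thereby
  moved into \<open>J^2\<close>, where \<open>\<psi>\<close> vanishes.\<close>

lemma radical_hom_mult:
  assumes \<psi>: "Vector_Spaces.linear scale (*) \<psi>" and zero: "\<And>w. w \<in> radical_square \<Longrightarrow> \<psi> w = 0"
    and I: "I \<in> R" and K: "K \<in> R" and x: "x \<in> I"
  shows "radical_hom I K \<psi> (x * a) - radical_hom I K \<psi> x * a \<in> K"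
proof -
  interpret \<psi>: Vector_Spaces.linear scale "(*)" \<psi> by (rule \<psi>)
  note rK = right_ideal_R[OF K]
  obtain c where c: "\<And>d. d * a - (\<Sum>b\<in>B K. scale (c d b) b) \<in> K"
    using coordinates_B[OF K, of "d * a" for d] by metis
  define y where "y = unit I 1 * x"
  have y: "y \<in> radical" unfolding y_def by (rule unit_left_mult[OF I x])
  have \<psi>y: "\<psi> (y * a * unit K b) = (\<Sum>d\<in>B K. c d b * \<psi> (y * unit K d))" if b: "b \<in> B K" for b
  proof -
    have "\<psi> (y * (a * unit K b - (\<Sum>d\<in>B K. scale (c d b) (unit K d)))) = 0"
      by (intro zero radical_square_mult y mult_unit_expand K b c)
    then show ?thesis
      by (simp add: right_diff_distrib sum_distrib_left \<psi>.diff \<psi>.sum \<psi>.scale mult.assoc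
        flip: scale_mult_right)
  qed
  have "radical_hom I K \<psi> (x * a) = (\<Sum>b\<in>B K. \<Sum>d\<in>B K. scale (\<psi> (y * unit K d)) (scale (c d b) b))"
    unfolding radical_hom_def mult.assoc[symmetric] y_def[symmetric]
    by (intro sum.cong refl) (simp add: \<psi>y scale_sum_left mult.commute)
  also have "\<dots> = (\<Sum>d\<in>B K. scale (\<psi> (y * unit K d)) (\<Sum>b\<in>B K. scale (c d b) b))"
    by (subst sum.swap) (simp add: scale_sum_right)
  finally have "radical_hom I K \<psi> (x * a) - radical_hom I K \<psi> x * a =
      - (\<Sum>d\<in>B K. scale (\<psi> (y * unit K d)) (d * a - (\<Sum>b\<in>B K. scale (c d b) b)))"
    by (simp add: radical_hom_def sum_distrib_right sum_subtractf scale_right_diff_distrib y_def scale_mult_left)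
  also have "\<dots> \<in> K"
    by (intro right_ideal_neg right_ideal_sum right_ideal_scale rK c)
  finally show ?thesis .
qed

text \<open>For \<open>z \<in> J\<close> the product \<open>t * z\<close> vanishes modulo
  \<open>K\<close>, hence so do all coordinates of \<open>radical_hom I K \<psi> z\<close>; the
  coordinate at \<open>1\<close> is the asserted value.\<close>

lemma sandwich_eq_zero:
  assumes K: "K \<in> R" and t: "radical_hom I K \<psi> z - t * z \<in> K" and z: "z \<in> radical"
  shows "\<psi> (unit I 1 * z * unit K 1) = 0"
proof -
  have "radical_hom I K \<psi> z \<in> K"
    using right_ideal_diff_cong[OF right_ideal_R[OF K] t] radicalD[OF radical_mult_left[OF z] K] by blast
  then show ?thesis
    unfolding radical_hom_def by (rule independent_B[OF K _ one_B[OF K]])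
qed

text \<open>A functional separating the corner element from \<open>J^2\<close> would define a
  self-extension that does not split.\<close>

lemma sandwich_self:
  assumes I: "I \<in> R" and x: "x \<in> radical"
  shows "unit I 1 * x * unit I 1 \<in> radical_square"
proof (rule ccontr)
  assume "unit I 1 * x * unit I 1 \<notin> radical_square"
  then obtain \<psi> where \<psi>: "Vector_Spaces.linear scale (*) \<psi>" "\<And>w. w \<in> radical_square \<Longrightarrow> \<psi> w = 0"
    "\<psi> (unit I 1 * x * unit I 1) = 1"
    using separating_functional[OF subspace_radical_power] by metis
  obtain t where "\<forall>y\<in>I. radical_hom I I \<psi> y - t * y \<in> I"
    using ext_self[OF I radical_hom_add[OF \<psi>(1)] radical_hom_mult[OF \<psi>(1,2) I I]] by blast
  then have "radical_hom I I \<psi> x - t * x \<in> I"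
    using radicalD[OF x I] by blast
  from sandwich_eq_zero[OF I this x] \<psi>(3) show False by simp
qed

text \<open>If two corner elements were independent modulo \<open>J^2\<close>, dual functionals
  \<open>\<psi>\<close> and \<open>\<mu>\<close> would give two extensions. A nontrivial combination
  of them splits by \<open>ext_distinct\<close>, and evaluation at \<open>x\<close> and
  \<open>y\<close> makes both coefficients zero.\<close>

lemma sandwich_distinct:
  assumes I: "I \<in> R" and K: "K \<in> R" and "I \<noteq> K"
  shows "\<exists>x\<in>radical. \<forall>y\<in>radical. \<exists>c.
    unit I 1 * y * unit K 1 - scale c (unit I 1 * x * unit K 1) \<in> radical_square"
proof (cases "\<forall>x\<in>radical. unit I 1 * x * unit K 1 \<in> radical_square")
  case True
  then show ?thesis
    by (intro bexI[of _ 0] ballI exI[of _ 0]) (auto intro: right_ideal_zero[OF right_ideal_radical])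
next
  case False
  let ?s = "\<lambda>x. unit I 1 * x * unit K 1"
  from False obtain x where x: "x \<in> radical" "?s x \<notin> radical_square" by blast
  have span2: "span radical_square = radical_square"
    by (intro span_eq_iff[THEN iffD2] subspace_radical_power)
  have "\<exists>c. ?s y - scale c (?s x) \<in> radical_square" if y: "y \<in> radical" for y
  proof (rule ccontr)
    assume no: "\<nexists>c. ?s y - scale c (?s x) \<in> radical_square"
    have nx: "?s x \<notin> span (insert (?s y) radical_square)"
    proof
      assume "?s x \<in> span (insert (?s y) radical_square)"
      then obtain k where k: "?s x - scale k (?s y) \<in> radical_square"
        unfolding span_breakdown_eq span2 by blast
      then have "k \<noteq> 0" using x(2) by auto
      have "scale (- inverse k) (?s x - scale k (?s y)) \<in> radical_square"
        by (intro radical_square_rules k)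
      then have "?s y - scale (inverse k) (?s x) \<in> radical_square"
        using \<open>k \<noteq> 0\<close> by (simp add: scale_right_diff_distrib)
      with no show False by blast
    qed
    have ny: "?s y \<notin> span (insert (?s x) radical_square)"
      using no unfolding span_breakdown_eq span2 by blast
    obtain \<psi> where \<psi>: "Vector_Spaces.linear scale (*) \<psi>" "\<And>w. w \<in> span (insert (?s y) radical_square) \<Longrightarrow> \<psi> w = 0"
      "\<psi> (?s x) = 1"
      using separating_functional[OF subspace_span nx] by metis
    obtain \<mu> where \<mu>: "Vector_Spaces.linear scale (*) \<mu>" "\<And>w. w \<in> span (insert (?s x) radical_square) \<Longrightarrow> \<mu> w = 0"
      "\<mu> (?s y) = 1"
      using separating_functional[OF subspace_span ny] by metis
    have vanish: "\<psi> w = 0" "\<mu> w = 0" if "w \<in> radical_square" for w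
      using that \<psi>(2) \<mu>(2) by (auto intro: span_base)
    have "\<psi> (?s y) = 0" "\<mu> (?s x) = 0"
      using \<psi>(2) \<mu>(2) by (auto intro: span_base)
    note vals = this \<psi>(3) \<mu>(3)
    obtain c d t where cd: "c \<noteq> 0 \<or> d \<noteq> 0"
      and t: "\<forall>y\<in>I. scale c (radical_hom I K \<psi> y) + scale d (radical_hom I K \<mu> y) - t * y \<in> K"
      using ext_distinct[OF I K \<open>I \<noteq> K\<close> radical_hom_add[OF \<psi>(1)] radical_hom_add[OF \<mu>(1)]
        radical_hom_mult[OF \<psi>(1) vanish(1) I K] radical_hom_mult[OF \<mu>(1) vanish(2) I K]] by blast
    \<comment> \<open>The combination is the \<open>radical_hom\<close> of the combined functional,
      so \<open>sandwich_eq_zero\<close> applies to it.\<close>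
    have comb: "radical_hom I K (\<lambda>w. c * \<psi> w + d * \<mu> w) z =
        scale c (radical_hom I K \<psi> z) + scale d (radical_hom I K \<mu> z)" for z
      by (simp add: radical_hom_def scale_left_distrib sum.distrib scale_sum_right)
    have "c * \<psi> (?s z) + d * \<mu> (?s z) = 0" if z: "z \<in> radical" for z
      using sandwich_eq_zero[OF K _ z, of I "\<lambda>w. c * \<psi> w + d * \<mu> w" t] t radicalD[OF z I]
      unfolding comb by blast
    from this[OF x(1)] this[OF y] have "c = 0" "d = 0" by (simp_all add: vals)
    with cd show False by blast
  qed
  with x(1) show ?thesis by blast
qed

lemma sandwich_line:
  assumes "I \<in> R" and "K \<in> R"
  shows "\<exists>x\<in>radical. \<forall>y\<in>radical. \<exists>c.
    unit I 1 * y * unit K 1 - scale c (unit I 1 * x * unit K 1) \<in> radical_square"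
proof (cases "I = K")
  case True
  then show ?thesis using sandwich_self[OF assms(1)]
    by (intro bexI[of _ 0] ballI exI[of _ 0]) (auto intro: right_ideal_zero[OF right_ideal_radical])
qed (rule sandwich_distinct[OF assms])

text \<open>A derivation into \<open>J\<close> preserves the corner modulo \<open>J^2\<close>,
  because the Leibniz terms differentiating \<open>unit I 1\<close> or \<open>unit K 1\<close> lie
  in \<open>J J\<close>. On a corner that is at most a line, \<open>D\<close> and \<open>E\<close>
  act as scalars \<open>c\<close> and \<open>d\<close>.\<close>

lemma sandwich_commutator:
  assumes D: "D \<in> derivations scale" "\<And>x. D x \<in> radical"
    and E: "E \<in> derivations scale" "\<And>x. E x \<in> radical"
    and I: "I \<in> R" and K: "K \<in> R" and x: "x \<in> radical"
  shows "D (E (unit I 1 * x * unit K 1)) - E (D (unit I 1 * x * unit K 1)) \<in> radical_square"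
proof -
  let ?s = "\<lambda>x. unit I 1 * x * unit K 1"
  obtain x0 where x0: "x0 \<in> radical" "\<And>y. y \<in> radical \<Longrightarrow> \<exists>c. ?s y - scale c (?s x0) \<in> radical_square"
    using sandwich_line[OF I K] by blast
  have eigen: "\<exists>c. F (?s x0) - scale c (?s x0) \<in> radical_square"
    if F: "F \<in> derivations scale" "\<And>x. F x \<in> radical" for F
  proof -
    obtain c where c: "?s (F x0) - scale c (?s x0) \<in> radical_square"
      using x0(2) F(2) by blast
    have "F (?s x0) - scale c (?s x0) =
        (F (unit I 1) * x0) * unit K 1 + unit I 1 * (x0 * F (unit K 1)) + (?s (F x0) - scale c (?s x0))"
      by (simp add: derivation_mult[OF F(1)] algebra_simps)
    also have "\<dots> \<in> radical_square"
      by (intro subspace_add[OF subspace_radical_power] c radical_power_mult_left radical_power_mult_right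
        radical_square_mult F x0)
    finally show ?thesis by blast
  qed
  obtain c where c: "D (?s x0) - scale c (?s x0) \<in> radical_square" using eigen[OF D] by blast
  obtain d where d: "E (?s x0) - scale d (?s x0) \<in> radical_square" using eigen[OF E] by blast
  obtain k where k: "?s x - scale k (?s x0) \<in> radical_square" using x0(2)[OF x] by blast
  note DE2 = derivation_radical_square[OF D] derivation_radical_square[OF E]
  \<comment> \<open>The scalar terms \<open>c d\<close> cancel; every remaining term is a multiple
    of an element of \<open>J^2\<close> or arises from one by applying \<open>D\<close> and
    \<open>E\<close>.\<close>
  have "D (E (?s x)) - E (D (?s x)) =
      (D (E (?s x - scale k (?s x0))) - E (D (?s x - scale k (?s x0)))) +
      scale k ((D (E (?s x0) - scale d (?s x0)) + scale d (D (?s x0) - scale c (?s x0)))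
       - (E (D (?s x0) - scale c (?s x0)) + scale c (E (?s x0) - scale d (?s x0))))"
    by (simp only: derivation_diff[OF D(1)] derivation_diff[OF E(1)] derivation_scale[OF D(1)] derivation_scale[OF E(1)]
      scale_right_diff_distrib scale_right_distrib scale_scale)
     (simp add: algebra_simps)
  also have "\<dots> \<in> radical_square"
    by (intro subspace_add[OF subspace_radical_power] subspace_diff[OF subspace_radical_power]
      subspace_scale[OF subspace_radical_power] DE2 c d k)
  finally show ?thesis .
qed

text \<open>Modulo \<open>J\<close> the identity is a sum \<open>s\<close> of products through the
  elements \<open>unit I 1\<close>, so modulo \<open>J^2\<close> each \<open>x\<close> in
  \<open>J\<close> is a sum of two-sided multiples of corner elements. Since \<open>M\<close> has
  values in \<open>J\<close>, the Leibniz rule reduces such multiples to the corners.\<close>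

lemma commutator_radical:
  assumes D: "D \<in> derivations scale" "\<And>x. D x \<in> radical"
    and E: "E \<in> derivations scale" "\<And>x. E x \<in> radical"
    and x: "x \<in> radical"
  shows "D (E x) - E (D x) \<in> radical_square"
proof -
  define M where "M x = D (E x) - E (D x)" for x
  have M: "M \<in> derivations scale"
    unfolding M_def by (rule derivation_bracket[OF D(1) E(1)])
  have Mr: "M x \<in> radical" for x
    unfolding M_def by (intro right_ideal_diff right_ideal_radical D E)
  have leibniz: "M (p * q * r) = M p * q * r + p * M q * r + p * (q * M r)" for p q r
    by (simp add: derivation_mult[OF M] algebra_simps)
  \<comment> \<open>\<open>unit I b\<close> sends \<open>b\<close> to \<open>1\<close>,
    \<open>unit I 1\<close> fixes \<open>1\<close>, and \<open>b\<close> sends \<open>1\<close> back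
    to \<open>b\<close>, so \<open>s\<close> acts as the identity on each
    \<open>A/I\<close>.\<close>
  define s where "s = (\<Sum>I\<in>R. \<Sum>b\<in>B I. unit I b * (unit I 1 * b))"
  have s: "s - 1 \<in> radical"
  proof (rule radicalI)
    fix I b assume I: "I \<in> R" and b: "b \<in> B I"
    have "(b * s - unit I 1 * b) + (1 * unit I 1 - 1) * b \<in> I"
      unfolding s_def
      by (intro right_ideal_add right_ideal_mult right_ideal_R unit_same one_B mult_unit_sum I b)
    then show "b * (s - 1) \<in> I" by (simp add: algebra_simps)
  qed
  have summand: "M ((unit I b * (unit I 1 * b)) * x * (unit K c * (unit K 1 * c))) \<in> radical_square"
    if "I \<in> R" "K \<in> R" for I K b c
  proof -
    let ?q = "unit I 1 * (b * x * unit K c) * unit K 1"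
    have q: "b * x * unit K c \<in> radical"
      by (rule right_ideal_mult[OF right_ideal_radical radical_mult_left[OF x]])
    have q': "?q \<in> radical"
      by (rule right_ideal_mult[OF right_ideal_radical radical_mult_left[OF q]])
    have Mq: "M ?q \<in> radical_square"
      unfolding M_def by (rule sandwich_commutator[OF D E that q])
    have "M (unit I b * ?q * c) = M (unit I b) * ?q * c + unit I b * M ?q * c + unit I b * (?q * M c)"
      by (rule leibniz)
    also have "\<dots> \<in> radical_square"
      by (intro subspace_add[OF subspace_radical_power] radical_power_mult_left[OF radical_square_mult]
        radical_power_mult_right[OF radical_square_mult] radical_power_mult_right[OF radical_power_mult_left]
        Mr q' Mq)
    finally show ?thesis by (simp add: mult.assoc)
  qed
  have row: "M ((unit I b * (unit I 1 * b)) * x * s) \<in> radical_square" if "I \<in> R" for I b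
    by (subst s_def, simp only: sum_distrib_left derivation_sum[OF M])
      (intro subspace_sum[OF subspace_radical_power] summand that)
  have 1: "M (s * x * s) \<in> radical_square"
    by (subst (1) s_def, simp only: sum_distrib_right derivation_sum[OF M])
      (intro subspace_sum[OF subspace_radical_power] row)
  \<comment> \<open>This is \<open>s * x * s - x\<close>, written with products of two elements of
    \<open>J\<close>.\<close>
  have "(s - 1) * x + (s * x) * (s - 1) \<in> radical_square"
    by (intro radical_square_rules s x radical_mult_left)
  then have "M ((s - 1) * x + (s * x) * (s - 1)) \<in> radical_square"
    by (rule derivation_radical_square[OF M Mr])
  moreover have "(s - 1) * x + (s * x) * (s - 1) = s * x * s - x"
    by (simp add: algebra_simps)
  ultimately have "M (s * x * s) - M (s * x * s - x) \<in> radical_square"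
    using 1 by (intro radical_square_rules) simp_all
  then show ?thesis
    unfolding M_def[symmetric] by (simp add: derivation_diff[OF M])
qed

lemma commutator_filtered:
  assumes D: "D \<in> derivations scale" and E: "E \<in> derivations scale"
  shows "\<exists>M\<in>filtered_derivations 1. \<exists>a. \<forall>x. D (E x) - E (D x) = M x + (a * x - x * a)"
proof -
  obtain a where a: "\<And>x. D x - (a * x - x * a) \<in> radical"
    using derivation_inner_mod_radical[OF D] by blast
  obtain b where b: "\<And>x. E x - (b * x - x * b) \<in> radical"
    using derivation_inner_mod_radical[OF E] by blast
  define D' where "D' x = D x - (a * x - x * a)" for x
  define E' where "E' x = E x - (b * x - x * b)" for x
  have D': "D' \<in> derivations scale" and E': "E' \<in> derivations scale"
    unfolding D'_def E'_def by (intro derivation_diff_mem inner_derivation D E)+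
  have rad: "D' x \<in> radical" "E' x \<in> radical" for x
    using a b by (simp_all add: D'_def E'_def)
  define M where "M x = D' (E' x) - E' (D' x)" for x
  have "M \<in> filtered_derivations 1"
    unfolding M_def
    by (intro filtered_derivations_oneI derivation_bracket commutator_radical D' E' rad
      right_ideal_diff right_ideal_radical)
  \<comment> \<open>With \<open>ad a\<close> for \<open>\<lambda>x. a * x - x * a\<close>, the inner
    part collects \<open>[D', ad b] = ad (D' b)\<close>, \<open>[ad a, E'] = - ad (E' a)\<close> and
    \<open>[ad a, ad b] = ad (a * b - b * a)\<close>.\<close>
  moreover have "D (E x) - E (D x) = M x + ((D' b - E' a + (a * b - b * a)) * x - x * (D' b - E' a + (a * b - b * a)))" for x
    unfolding M_def D'_def E'_def
    by (simp add: derivation_diff[OF D] derivation_diff[OF E] derivation_add[OF D] derivation_add[OF E] derivation_mult[OF D] derivation_mult[OF E] algebra_simps)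
  ultimately show ?thesis by blast
qed

end

section \<open>Extensions of simple modules\<close>

lemma vectorspace_small_dim_dependent:
  fixes V :: "('k::field, 'v, 'x) module_scheme" (structure)
  assumes vs: "vectorspace class_ring V" and fd: "vectorspace.fin_dim class_ring V"
    and A: "finite A" "A \<subseteq> carrier V" "vectorspace.dim class_ring V < card A"
  shows "\<exists>a v. v \<in> A \<and> a v \<noteq> 0 \<and> (\<Oplus>\<^bsub>V\<^esub>v\<in>A. a v \<odot>\<^bsub>V\<^esub> v) = \<zero>\<^bsub>V\<^esub>"
proof -
  interpret vectorspace class_ring V by (rule vs)
  have "lin_dep A"
    using li_le_dim(2)[OF fd A(2)] A(3) by linarith
  then show ?thesis
    using finite_lin_dep[OF A(1) _ A(2)] unfolding lincomb_def by auto
qed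

lemma vectorspace_dim_zero:
  fixes V :: "('k::field, 'v, 'x) module_scheme" (structure)
  assumes vs: "vectorspace class_ring V" and fd: "vectorspace.fin_dim class_ring V"
    and dim: "vectorspace.dim class_ring V = 0" and x: "x \<in> carrier V"
  shows "x = \<zero>\<^bsub>V\<^esub>"
proof -
  interpret vectorspace class_ring V by (rule vs)
  obtain a :: "'v \<Rightarrow> 'k" where a: "a x \<noteq> 0" "(\<Oplus>\<^bsub>V\<^esub>v\<in>{x}. a v \<odot>\<^bsub>V\<^esub> v) = \<zero>\<^bsub>V\<^esub>"
    using vectorspace_small_dim_dependent[OF vs fd, of "{x}"] x dim by auto
  then have "a x \<odot>\<^bsub>V\<^esub> x = \<zero>\<^bsub>V\<^esub>"
    using x by simp
  then have "(inverse (a x) * a x) \<odot>\<^bsub>V\<^esub> x = inverse (a x) \<odot>\<^bsub>V\<^esub> \<zero>\<^bsub>V\<^esub>"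
    using smult_assoc1[of "inverse (a x)" "a x" x] x by simp
  then show ?thesis
    using a(1) x smult_one[of x] rmult_0[of "inverse (a x)"] by simp
qed

lemma vectorspace_dim_le_one:
  fixes V :: "('k::field, 'v, 'x) module_scheme" (structure)
  assumes vs: "vectorspace class_ring V" and fd: "vectorspace.fin_dim class_ring V"
    and dim: "vectorspace.dim class_ring V \<le> 1" and x: "x \<in> carrier V" and y: "y \<in> carrier V"
  shows "\<exists>c d. (c \<noteq> 0 \<or> d \<noteq> 0) \<and> c \<odot>\<^bsub>V\<^esub> x \<oplus>\<^bsub>V\<^esub> d \<odot>\<^bsub>V\<^esub> y = \<zero>\<^bsub>V\<^esub>"
proof -
  interpret vectorspace class_ring V by (rule vs)
  show ?thesis
  proof (cases "x = y")
    case True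
    \<comment> \<open>\<open>{x, y}\<close> has one element here, so the dimension bound gives no
      relation and the trivial one is used.\<close>
    have "(1 + - 1) \<odot>\<^bsub>V\<^esub> x = \<zero>\<^bsub>V\<^esub>"
      using lmult_0[of x] x by simp
    then have "1 \<odot>\<^bsub>V\<^esub> x \<oplus>\<^bsub>V\<^esub> (- 1) \<odot>\<^bsub>V\<^esub> x = \<zero>\<^bsub>V\<^esub>"
      using smult_l_distr[of 1 "- 1" x] x by simp
    then show ?thesis unfolding True by (intro exI[of _ 1] exI[of _ "- 1"]) auto
  next
    case False
    then obtain a v where a: "v \<in> {x, y}" "a v \<noteq> 0" "(\<Oplus>\<^bsub>V\<^esub>v\<in>{x, y}. a v \<odot>\<^bsub>V\<^esub> v) = \<zero>\<^bsub>V\<^esub>"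
      using vectorspace_small_dim_dependent[OF vs fd, of "{x, y}"] x y dim by auto
    have "(\<Oplus>\<^bsub>V\<^esub>v\<in>{x, y}. a v \<odot>\<^bsub>V\<^esub> v) = a x \<odot>\<^bsub>V\<^esub> x \<oplus>\<^bsub>V\<^esub> a y \<odot>\<^bsub>V\<^esub> y"
      using False x y by (subst finsum_insert) auto
    with a show ?thesis by (intro exI[of _ "a x"] exI[of _ "a y"]) auto
  qed
qed

section \<open>Quotients of vector spaces\<close>

locale vector_quotient = vectorspace class_ring V
  for V :: "('k::field, 'v, 'x) module_scheme" (structure) +
  fixes W :: "'v set"
  assumes W: "VectorSpace.subspace class_ring W V"
begin

lemma
  shows W_subset: "W \<subseteq> carrier V"
    and W_zero: "\<zero> \<in> W"
    and W_add: "x \<in> W \<Longrightarrow> y \<in> W \<Longrightarrow> x \<oplus> y \<in> W"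
    and W_smult: "x \<in> W \<Longrightarrow> c \<odot> x \<in> W"
  using W unfolding VectorSpace.subspace_def submodule_def by auto

sublocale abelian_subgroup W V
proof (rule abelian_subgroupI3[OF additive_subgroupI])
  show "subgroup W (add_monoid V)"
  proof
    fix x assume x: "x \<in> W"
    then have "\<ominus> x = (- 1) \<odot> x"
      using smult_minus_1[of x] W_subset by (auto simp: class_ring_simps)
    then show "inv\<^bsub>add_monoid V\<^esub> x \<in> W"
      using W_smult[OF x, of "- 1"] by (simp add: a_inv_def)
  qed (use W_subset W_zero W_add in auto)
qed (rule abelian_group_axioms)

abbreviation quotient :: "('k, 'v set) module" where
  "quotient \<equiv> quotient_space V W"

lemma carrier_quotient: "carrier quotient = (\<lambda>x. W +> x) ` carrier V"
  by (auto simp: quotient_space_def A_RCOSETS_def')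

lemma zero_quotient: "\<zero>\<^bsub>quotient\<^esub> = W"
  by (simp add: quotient_space_def)

lemma add_quotient:
  "x \<in> carrier V \<Longrightarrow> y \<in> carrier V \<Longrightarrow> (W +> x) \<oplus>\<^bsub>quotient\<^esub> (W +> y) = W +> (x \<oplus> y)"
  by (simp add: quotient_space_def a_rcos_sum)

lemma coset_mem: "y \<in> W +> x \<longleftrightarrow> (\<exists>w\<in>W. y = w \<oplus> x)"
  by (auto simp: a_r_coset_def')

text \<open>\<open>quotient_space\<close> takes a union over all representatives; the cosets in that
  union coincide, and there is at least one.\<close>

lemma smult_quotient:
  assumes x: "x \<in> carrier V"
  shows "c \<odot>\<^bsub>quotient\<^esub> (W +> x) = W +> (c \<odot> x)"
proof -
  have "W +> (c \<odot> y) = W +> (c \<odot> x)" if "y \<in> W +> x" for y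
  proof -
    have "\<exists>w\<in>W. y = w \<oplus> x"
      using that by (simp only: coset_mem)
    then obtain w where w: "w \<in> W" "y = w \<oplus> x" ..
    then have "c \<odot> y = c \<odot> w \<oplus> c \<odot> x"
      using W_subset x by (auto simp: smult_r_distr)
    then have "c \<odot> y \<in> W +> (c \<odot> x)"
      unfolding coset_mem using W_smult[OF w(1)] by blast
    then show ?thesis
      using a_repr_independence' x by simp
  qed
  then have "(\<Union>y\<in>W +> x. W +> (c \<odot> y)) = (\<Union>y\<in>W +> x. W +> (c \<odot> x))"
    by (rule SUP_cong[OF refl])
  also have "\<dots> = W +> (c \<odot> x)"
    using a_rcos_self[OF x] by blast
  finally show ?thesis by (simp add: quotient_space_def)
qed

lemma coset_eq_zero_iff: "x \<in> carrier V \<Longrightarrow> W +> x = W \<longleftrightarrow> x \<in> W"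
  using a_rcos_const a_rcos_self by blast

lemmas quotient_simps = carrier_quotient zero_quotient add_quotient smult_quotient

lemma smult_rules:
  assumes "x \<in> carrier V"
  shows "(a + b) \<odot> x = a \<odot> x \<oplus> b \<odot> x" "(a * b) \<odot> x = a \<odot> (b \<odot> x)" "1 \<odot> x = x"
    "a \<odot> x \<in> carrier V"
  using assms smult_l_distr[of a b x] smult_assoc1[of a b x] smult_one[of x] smult_closed[of a x] by simp_all

lemma vectorspace_quotient: "vectorspace class_ring quotient"
proof (rule vs_criteria[OF class_field])
  have zero: "W = W +> \<zero>" using coset_eq_zero_iff W_zero by blast
  show "\<zero>\<^bsub>quotient\<^esub> \<in> carrier quotient"
    unfolding quotient_simps by (subst zero) blast
  show "\<forall>v\<in>carrier quotient. \<exists>w\<in>carrier quotient. v \<oplus>\<^bsub>quotient\<^esub> w = \<zero>\<^bsub>quotient\<^esub>"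
  proof
    fix v assume "v \<in> carrier quotient"
    then obtain x where x: "v = W +> x" "x \<in> carrier V" unfolding carrier_quotient by blast
    then have "v \<oplus>\<^bsub>quotient\<^esub> (W +> (\<ominus> x)) = \<zero>\<^bsub>quotient\<^esub>"
      using zero by (simp add: add_quotient zero_quotient r_neg)
    then show "\<exists>w\<in>carrier quotient. v \<oplus>\<^bsub>quotient\<^esub> w = \<zero>\<^bsub>quotient\<^esub>"
      using x(2) unfolding carrier_quotient by blast
  qed
  show "\<forall>v\<in>carrier quotient. v \<oplus>\<^bsub>quotient\<^esub> \<zero>\<^bsub>quotient\<^esub> = v"
  proof
    fix v assume "v \<in> carrier quotient"
    then obtain x where "v = W +> x" "x \<in> carrier V" unfolding carrier_quotient by blast
    then show "v \<oplus>\<^bsub>quotient\<^esub> \<zero>\<^bsub>quotient\<^esub> = v"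
      using add_quotient[of x \<zero>] zero by (simp add: zero_quotient)
  qed
  show "\<forall>v w. v \<in> carrier quotient \<and> w \<in> carrier quotient \<longrightarrow> v \<oplus>\<^bsub>quotient\<^esub> w = w \<oplus>\<^bsub>quotient\<^esub> v"
    by (auto simp: carrier_quotient add_quotient a_comm)
  show "\<forall>v w x. v \<in> carrier quotient \<and> w \<in> carrier quotient \<and> x \<in> carrier quotient \<longrightarrow>
      v \<oplus>\<^bsub>quotient\<^esub> w \<oplus>\<^bsub>quotient\<^esub> x = v \<oplus>\<^bsub>quotient\<^esub> (w \<oplus>\<^bsub>quotient\<^esub> x)"
    by (auto simp: carrier_quotient add_quotient a_assoc)
qed (auto simp: carrier_quotient add_quotient smult_quotient smult_rules smult_r_distr)

end

context right_module
begin

lemma zero_smult: "m \<in> carrier M \<Longrightarrow> 0 \<odot> m = \<zero>"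
  using smult_add_left[of m 0 0] smult_closed[of m 0] by (metis add.r_cancel_one' add.right_neutral)

lemma smult_zero: "a \<odot> \<zero> = \<zero>"
  using smult_add_right[of \<zero> \<zero> a] smult_closed[of \<zero> a] by (metis add.r_cancel_one' r_zero zero_closed)

end

section \<open>Spaces of module homomorphisms\<close>

lemma homsI:
  assumes "\<And>x. x \<in> carrier M \<Longrightarrow> f x \<in> carrier N"
    and "\<And>x y. x \<in> carrier M \<Longrightarrow> y \<in> carrier M \<Longrightarrow> f (x \<oplus>\<^bsub>M\<^esub> y) = f x \<oplus>\<^bsub>N\<^esub> f y"
    and "\<And>a x. x \<in> carrier M \<Longrightarrow> f (a \<odot>\<^bsub>M\<^esub> x) = a \<odot>\<^bsub>N\<^esub> f x"
  shows "f \<in> homs M N"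
  using assms unfolding LinearCombinations.module_hom_def by auto

lemma
  assumes "f \<in> homs M N" "x \<in> carrier M"
  shows homs_closed: "f x \<in> carrier N"
    and homs_add: "y \<in> carrier M \<Longrightarrow> f (x \<oplus>\<^bsub>M\<^esub> y) = f x \<oplus>\<^bsub>N\<^esub> f y"
    and homs_smult: "f (a \<odot>\<^bsub>M\<^esub> x) = a \<odot>\<^bsub>N\<^esub> f x"
  using assms unfolding LinearCombinations.module_hom_def by auto

lemma hom_space_simps:
  "carrier (hom_space scale M N) = homs M N \<inter> extensional (carrier M)"
  "\<zero>\<^bsub>hom_space scale M N\<^esub> = (\<lambda>x\<in>carrier M. \<zero>\<^bsub>N\<^esub>)"
  "f \<oplus>\<^bsub>hom_space scale M N\<^esub> g = (\<lambda>x\<in>carrier M. f x \<oplus>\<^bsub>N\<^esub> g x)"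
  "c \<odot>\<^bsub>hom_space scale M N\<^esub> f = (\<lambda>x\<in>carrier M. scale c 1 \<odot>\<^bsub>N\<^esub> f x)"
  by (simp_all add: hom_space_def)

lemma restrict_homs:
  assumes "right_module M"
  shows "restrict f (carrier M) \<in> homs M N \<longleftrightarrow> f \<in> homs M N"
proof -
  interpret M: right_module M by (rule assms)
  show ?thesis
    unfolding LinearCombinations.module_hom_def by (auto simp: M.smult_closed Pi_iff)
qed

context fin_dim_algebra
begin

lemma vectorspace_hom_space:
  fixes M :: "('a, 'm) module" and N :: "('a, 'n) module"
  assumes "right_module M" "right_module N"
  shows "vectorspace class_ring (hom_space scale M N)"
proof -
  interpret M: right_module M by fact
  interpret N: right_module N by fact
  let ?H = "hom_space scale M N"
  have cl: "f x \<in> carrier N" if "f \<in> homs M N" "x \<in> carrier M" for f x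
    using that by (rule homs_closed)
  have eqI: "f = g" if "f \<in> carrier ?H" "g \<in> carrier ?H" "\<And>x. x \<in> carrier M \<Longrightarrow> f x = g x" for f g
    using that unfolding hom_space_simps by (auto intro: extensionalityI)
  have zero: "\<zero>\<^bsub>?H\<^esub> \<in> carrier ?H"
    unfolding hom_space_simps restrict_homs[OF assms(1)] Int_iff
    by (auto intro!: homsI simp: N.smult_zero)
  have add: "f \<oplus>\<^bsub>?H\<^esub> g \<in> carrier ?H" if "f \<in> carrier ?H" "g \<in> carrier ?H" for f g
    using that unfolding hom_space_simps Int_iff restrict_homs[OF assms(1)]
    by (auto intro!: homsI simp: homs_add homs_smult cl N.smult_add_right N.add.m_ac)
  have smult: "c \<odot>\<^bsub>?H\<^esub> f \<in> carrier ?H" if "f \<in> carrier ?H" for c f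
  proof -
    \<comment> \<open>\<open>scale c 1\<close> is central in \<open>A\<close>, which makes a scalar
      multiple of a homomorphism linear over \<open>A\<close>.\<close>
    have "scale c 1 \<odot>\<^bsub>N\<^esub> (a \<odot>\<^bsub>N\<^esub> y) = a \<odot>\<^bsub>N\<^esub> (scale c 1 \<odot>\<^bsub>N\<^esub> y)" if "y \<in> carrier N" for a y
      using that by (simp flip: N.smult_mult scale_eq_mult scale_eq_mult')
    then show ?thesis
      using that unfolding hom_space_simps Int_iff restrict_homs[OF assms(1)]
      by (auto intro!: homsI simp: homs_add homs_smult cl N.smult_add_right N.smult_closed)
  qed
  have val: "(f \<oplus>\<^bsub>?H\<^esub> g) x = f x \<oplus>\<^bsub>N\<^esub> g x" "(c \<odot>\<^bsub>?H\<^esub> f) x = scale c 1 \<odot>\<^bsub>N\<^esub> f x" "\<zero>\<^bsub>?H\<^esub> x = \<zero>\<^bsub>N\<^esub>"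
    if "x \<in> carrier M" for f g c x
    using that by (simp_all add: hom_space_simps)
  have clH: "f x \<in> carrier N" if "f \<in> carrier ?H" "x \<in> carrier M" for f x
    using that cl by (simp add: hom_space_simps)
  have mult1: "scale (c * d) 1 = scale d 1 * scale c 1" for c d
    by (simp add: mult.commute flip: scale_mult_left)
  show ?thesis
  proof (rule vs_criteria[OF class_field])
    show "\<forall>f\<in>carrier ?H. \<exists>g\<in>carrier ?H. f \<oplus>\<^bsub>?H\<^esub> g = \<zero>\<^bsub>?H\<^esub>"
    proof
      fix f assume f: "f \<in> carrier ?H"
      have "y \<oplus>\<^bsub>N\<^esub> scale (- 1) 1 \<odot>\<^bsub>N\<^esub> y = \<zero>\<^bsub>N\<^esub>" if "y \<in> carrier N" for y
        using that N.smult_add_left[of y 1 "- 1"] by (simp add: N.smult_one N.zero_smult)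
      then have "f \<oplus>\<^bsub>?H\<^esub> ((- 1) \<odot>\<^bsub>?H\<^esub> f) = \<zero>\<^bsub>?H\<^esub>"
        by (intro eqI add smult zero f) (simp add: val clH[OF f])
      then show "\<exists>g\<in>carrier ?H. f \<oplus>\<^bsub>?H\<^esub> g = \<zero>\<^bsub>?H\<^esub>"
        using smult[OF f] by blast
    qed
  qed (auto intro!: eqI zero add smult simp: val clH N.add.m_ac N.smult_closed N.smult_add_right
      N.smult_add_left scale_left_distrib mult1 N.smult_mult N.smult_one)
qed

section \<open>The modules \<open>A/I\<close>\<close>

definition coset :: "'a set \<Rightarrow> 'a \<Rightarrow> 'a set" where
  "coset I a = {x. x - a \<in> I}"

text \<open>The representative of the coset of \<open>1\<close> is \<open>1\<close>, so that the generator of \<open>A/I\<close> has the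
  expected representative.\<close>

definition rep :: "'a set \<Rightarrow> 'a" where
  "rep X = (if 1 \<in> X then 1 else SOME x. x \<in> X)"

text \<open>The elements are cosets, so \<open>A/I\<close> has the type over which the hypotheses on
  Ext quantify.\<close>

definition quotient_module :: "'a set \<Rightarrow> ('a, 'a set) module" where
  "quotient_module I =
    \<lparr>carrier = range (coset I), mult = undefined, one = undefined, zero = I,
     add = (\<lambda>X Y. coset I (rep X + rep Y)), smult = (\<lambda>a X. coset I (rep X * a))\<rparr>"

lemma coset_eq_iff:
  assumes "right_ideal I" shows "coset I a = coset I b \<longleftrightarrow> a - b \<in> I"
proof
  assume "coset I a = coset I b"
  moreover have "a \<in> coset I a"
    by (simp add: coset_def right_ideal_zero[OF assms])
  ultimately show "a - b \<in> I"
    by (auto simp: coset_def)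
next
  assume "a - b \<in> I"
  then have "x - a \<in> I \<longleftrightarrow> x - b \<in> I" for x
    using right_ideal_diff_cong[OF assms, of "x - b" "x - a"] by simp
  then show "coset I a = coset I b"
    by (auto simp: coset_def)
qed

lemma coset_zero: "coset I 0 = I"
  by (simp add: coset_def)

lemma rep_coset: assumes "right_ideal I" shows "rep (coset I a) - a \<in> I"
proof -
  have "a \<in> coset I a"
    by (simp add: coset_def right_ideal_zero[OF assms])
  then have "(SOME x. x \<in> coset I a) \<in> coset I a" by (rule someI)
  then have "rep (coset I a) \<in> coset I a" unfolding rep_def by simp
  then show ?thesis by (simp add: coset_def)
qed

lemma rep_coset_one: "right_ideal I \<Longrightarrow> rep (coset I 1) = 1"
  by (simp add: rep_def coset_def right_ideal_zero)

lemma coset_rep: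
  assumes "right_ideal I" "X \<in> carrier (quotient_module I)" shows "coset I (rep X) = X"
proof -
  obtain a where "X = coset I a"
    using assms(2) by (auto simp: quotient_module_def)
  then show ?thesis
    using rep_coset[OF assms(1)] coset_eq_iff[OF assms(1)] by simp
qed

lemma
  assumes I: "right_ideal I"
  shows carrier_quotient_module: "carrier (quotient_module I) = range (coset I)"
    and zero_quotient_module: "\<zero>\<^bsub>quotient_module I\<^esub> = coset I 0"
    and add_quotient_module: "coset I a \<oplus>\<^bsub>quotient_module I\<^esub> coset I b = coset I (a + b)"
    and smult_quotient_module: "x \<odot>\<^bsub>quotient_module I\<^esub> coset I a = coset I (a * x)"
proof -
  show "coset I a \<oplus>\<^bsub>quotient_module I\<^esub> coset I b = coset I (a + b)"
    using right_ideal_add[OF I rep_coset[OF I, of a] rep_coset[OF I, of b]]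
    by (simp add: quotient_module_def coset_eq_iff[OF I] algebra_simps)
  show "x \<odot>\<^bsub>quotient_module I\<^esub> coset I a = coset I (a * x)"
    using right_ideal_mult[OF I rep_coset[OF I, of a], of x]
    by (simp add: quotient_module_def coset_eq_iff[OF I] algebra_simps)
qed (simp_all add: quotient_module_def coset_zero)

lemmas quotient_module_simps =
  carrier_quotient_module zero_quotient_module add_quotient_module smult_quotient_module

lemma right_module_quotient_module:
  assumes I: "right_ideal I" shows "right_module (quotient_module I)"
proof (intro right_module.intro right_module_axioms.intro abelian_groupI)
  fix X assume "X \<in> carrier (quotient_module I)"
  then obtain a where "X = coset I a" by (auto simp: quotient_module_simps[OF I])
  then have "coset I (- a) \<oplus>\<^bsub>quotient_module I\<^esub> X = \<zero>\<^bsub>quotient_module I\<^esub>"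
    by (simp add: quotient_module_simps[OF I])
  then show "\<exists>Y\<in>carrier (quotient_module I). Y \<oplus>\<^bsub>quotient_module I\<^esub> X = \<zero>\<^bsub>quotient_module I\<^esub>"
    by (auto simp: carrier_quotient_module[OF I])
qed (auto simp: quotient_module_simps[OF I] algebra_simps)

lemma simple_quotient_module:
  assumes I: "maximal_right_ideal I" shows "simple_module (quotient_module I)"
  unfolding simple_module_def
proof (intro conjI allI impI)
  note rI = maximal_right_ideal[OF I]
  note simps = quotient_module_simps[OF rI]
  show "right_module (quotient_module I)"
    by (rule right_module_quotient_module[OF rI])
  have "coset I 1 \<noteq> coset I 0"
    using maximal_one[OF I] by (simp add: coset_eq_iff[OF rI])
  then show "carrier (quotient_module I) \<noteq> {\<zero>\<^bsub>quotient_module I\<^esub>}"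
    by (auto simp: simps)
  fix N assume N: "right_submodule N (quotient_module I)"
  then have sub: "N \<subseteq> range (coset I)" by (simp add: right_submodule_def simps)
  let ?K = "{a. coset I a \<in> N}"
  have 0: "coset I 0 \<in> N" using N by (simp add: right_submodule_def simps)
  have K: "right_ideal ?K"
  proof (rule right_idealI)
    show "0 \<in> ?K" using 0 by simp
    show "a + b \<in> ?K" if "a \<in> ?K" "b \<in> ?K" for a b
      using N that by (auto simp: right_submodule_def simp flip: add_quotient_module[OF rI])
    show "a * b \<in> ?K" if "a \<in> ?K" for a b
      using N that by (auto simp: right_submodule_def simp flip: smult_quotient_module[OF rI])
  qed
  have IK: "I \<subseteq> ?K"
  proof
    fix i assume "i \<in> I"
    then have "coset I i = coset I 0" by (simp add: coset_eq_iff[OF rI])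
    then show "i \<in> ?K" using 0 by simp
  qed
  show "N = {\<zero>\<^bsub>quotient_module I\<^esub>} \<or> N = carrier (quotient_module I)"
  proof (cases "?K = UNIV")
    case True
    then show ?thesis using sub by (auto simp: simps)
  next
    case False
    then have KI: "?K = I"
      using maximal_eq[OF I K IK] right_ideal_one_iff[OF K] by blast
    have "X = coset I 0" if X: "X \<in> N" for X
    proof -
      obtain a where a: "X = coset I a" using sub X by blast
      then have "a \<in> I" using X KI by blast
      then show ?thesis by (simp add: a coset_eq_iff[OF rI])
    qed
    then have "N = {coset I 0}" using 0 by blast
    then show ?thesis by (simp add: simps)
  qed
qed

text \<open>A homomorphism is left multiplication by a representative \<open>x\<close> of the image
  of \<open>1 + I\<close>; triviality gives \<open>x \<in> K\<close>, so it is zero and cannot be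
  injective.\<close>

lemma not_isomorphic_quotient_module:
  assumes I: "maximal_right_ideal I" and K: "right_ideal K" and triv: "hom_trivial I K"
  shows "\<not> module_isomorphic (quotient_module I) (quotient_module K)"
proof
  note rI = maximal_right_ideal[OF I]
  assume "module_isomorphic (quotient_module I) (quotient_module K)"
  then obtain f where f: "f \<in> homs (quotient_module I) (quotient_module K)"
    and inj: "inj_on f (carrier (quotient_module I))"
    unfolding module_isomorphic_def bij_betw_def by blast
  have mem: "coset I a \<in> carrier (quotient_module I)" for a
    by (simp add: carrier_quotient_module[OF rI])
  obtain x where x: "f (coset I 1) = coset K x"
    using homs_closed[OF f mem[of 1]] by (auto simp: carrier_quotient_module[OF K])
  have fa: "f (coset I a) = coset K (x * a)" for a
    using homs_smult[OF f mem[of 1], of a] by (simp add: smult_quotient_module[OF rI] smult_quotient_module[OF K] x)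
  have "x * i \<in> K" if "i \<in> I" for i
  proof -
    have "coset I i = coset I 0" using that by (simp add: coset_eq_iff[OF rI])
    then have "coset K (x * i) = coset K (x * 0)" using fa by metis
    then show ?thesis by (simp add: coset_eq_iff[OF K])
  qed
  then have "x \<in> K" using triv unfolding hom_trivial_def by blast
  then have "f (coset I 1) = f (coset I 0)" by (simp add: fa coset_eq_iff[OF K])
  then have "coset I 1 = coset I 0" using inj mem unfolding inj_on_def by blast
  then show False using maximal_one[OF I] by (simp add: coset_eq_iff[OF rI])
qed

end

section \<open>Free modules and the canonical presentation of \<open>A/I\<close>\<close>

lemma free_module_simps:
  "carrier (free_module X) = {f. finite {x. f x \<noteq> 0} \<and> {x. f x \<noteq> 0} \<subseteq> X}"
  "\<zero>\<^bsub>free_module X\<^esub> = (\<lambda>x. 0)"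
  "f \<oplus>\<^bsub>free_module X\<^esub> g = (\<lambda>x. f x + g x)"
  "a \<odot>\<^bsub>free_module X\<^esub> f = (\<lambda>x. f x * a)"
  by (simp_all add: free_module_def)

lemma free_module_add_closed:
  assumes "f \<in> carrier (free_module X)" "g \<in> carrier (free_module X)"
  shows "(\<lambda>x. f x + g x) \<in> carrier (free_module X)"
proof -
  have "{x. f x + g x \<noteq> 0} \<subseteq> {x. f x \<noteq> 0} \<union> {x. g x \<noteq> 0}" by auto
  then show ?thesis
    using assms unfolding free_module_simps by (auto intro: finite_subset)
qed

lemma free_module_mult_closed:
  assumes "f \<in> carrier (free_module X)"
  shows "(\<lambda>x. f x * a) \<in> carrier (free_module X)"
proof -
  have "{x. f x * a \<noteq> 0} \<subseteq> {x. f x \<noteq> 0}" by auto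
  then show ?thesis
    using assms unfolding free_module_simps by (auto intro: finite_subset)
qed

lemma right_module_free_module: "right_module (free_module X)"
proof (intro right_module.intro right_module_axioms.intro abelian_groupI)
  fix f assume "f \<in> carrier (free_module X)"
  then have "(\<lambda>x. f x * (- 1)) \<in> carrier (free_module X)" by (rule free_module_mult_closed)
  then show "\<exists>g\<in>carrier (free_module X). g \<oplus>\<^bsub>free_module X\<^esub> f = \<zero>\<^bsub>free_module X\<^esub>"
    by (rule bexI[rotated]) (simp add: free_module_simps(2,3))
qed (auto simp: free_module_add_closed free_module_mult_closed free_module_simps(2-4) algebra_simps,
   simp add: free_module_simps)

context fin_dim_algebra
begin

text \<open>A lift of \<open>free_cover (quotient_module I)\<close> along
  \<open>A \<rightarrow> A/I\<close>. It maps the canonical presentation to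
  \<open>I \<rightarrow> A \<rightarrow> A/I\<close>, and the syzygy is the preimage of
  \<open>I\<close>.\<close>

definition cover :: "('a set \<Rightarrow> 'a) \<Rightarrow> 'a" where
  "cover f = (\<Sum>X | f X \<noteq> 0. rep X * f X)"

lemma cover_superset:
  assumes "finite A" "{X. f X \<noteq> 0} \<subseteq> A" shows "cover f = (\<Sum>X\<in>A. rep X * f X)"
  unfolding cover_def using assms by (intro sum.mono_neutral_left) auto

lemma cover_add:
  assumes "finite {X. f X \<noteq> 0}" "finite {X. g X \<noteq> 0}"
  shows "cover (\<lambda>X. f X + g X) = cover f + cover g"
proof -
  let ?A = "{X. f X \<noteq> 0} \<union> {X. g X \<noteq> 0}"
  have "cover (\<lambda>X. f X + g X) = (\<Sum>X\<in>?A. rep X * (f X + g X))"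
    using assms by (intro cover_superset) auto
  also have "\<dots> = cover f + cover g"
    using assms by (subst (1 2) cover_superset[of ?A]) (auto simp: distrib_left sum.distrib)
  finally show ?thesis .
qed

lemma cover_mult:
  assumes "finite {X. f X \<noteq> 0}" shows "cover (\<lambda>X. f X * a) = cover f * a"
  using assms by (subst (1 2) cover_superset[of "{X. f X \<noteq> 0}"]) (auto simp: sum_distrib_right mult.assoc)

lemma free_cover_quotient_module:
  assumes I: "right_ideal I" and f: "f \<in> carrier (free_module (carrier (quotient_module I)))"
  shows "free_cover (quotient_module I) f = coset I (cover f)"
proof -
  interpret Q: right_module "quotient_module I" by (rule right_module_quotient_module[OF I])
  have "(\<Oplus>\<^bsub>quotient_module I\<^esub>X\<in>A. f X \<odot>\<^bsub>quotient_module I\<^esub> X) = coset I (\<Sum>X\<in>A. rep X * f X)"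
    if "finite A" "A \<subseteq> carrier (quotient_module I)" for A
    using that
  proof (induction A)
    case (insert X A)
    have "f X \<odot>\<^bsub>quotient_module I\<^esub> X = coset I (rep X * f X)"
      using coset_rep[OF I, of X] insert.prems smult_quotient_module[OF I] by (metis insert_subset)
    moreover have "(\<Oplus>\<^bsub>quotient_module I\<^esub>Y\<in>insert X A. f Y \<odot>\<^bsub>quotient_module I\<^esub> Y) =
        f X \<odot>\<^bsub>quotient_module I\<^esub> X \<oplus>\<^bsub>quotient_module I\<^esub> (\<Oplus>\<^bsub>quotient_module I\<^esub>Y\<in>A. f Y \<odot>\<^bsub>quotient_module I\<^esub> Y)"
      using insert.hyps insert.prems by (intro Q.finsum_insert Pi_I Q.smult_closed) auto
    ultimately show ?case
      using insert by (simp add: add_quotient_module[OF I])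
  qed (simp add: zero_quotient_module[OF I])
  then show ?thesis
    using f unfolding free_cover_def cover_def by (auto simp: free_module_simps)
qed

lemma carrier_syzygy:
  assumes I: "right_ideal I"
  shows "carrier (syzygy (quotient_module I)) =
    {f \<in> carrier (free_module (carrier (quotient_module I))). cover f \<in> I}"
  by (simp add: syzygy_def free_cover_quotient_module[OF I] zero_quotient_module[OF I]
      coset_eq_iff[OF I] cong: conj_cong)

lemma syzygy_simps:
  "\<zero>\<^bsub>syzygy M\<^esub> = (\<lambda>x. 0)" "f \<oplus>\<^bsub>syzygy M\<^esub> g = (\<lambda>x. f x + g x)" "a \<odot>\<^bsub>syzygy M\<^esub> f = (\<lambda>x. f x * a)"
  by (simp_all add: syzygy_def free_module_simps)

lemma
  assumes I: "right_ideal I" and f: "f \<in> carrier (syzygy (quotient_module I))"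
  shows syzygy_cover: "cover f \<in> I"
    and syzygy_finite: "finite {X. f X \<noteq> 0}"
    and syzygy_mult_closed: "(\<lambda>x. f x * a) \<in> carrier (syzygy (quotient_module I))"
    and syzygy_add_closed: "g \<in> carrier (syzygy (quotient_module I)) \<Longrightarrow>
      (\<lambda>x. f x + g x) \<in> carrier (syzygy (quotient_module I))"
proof -
  have *: "cover f \<in> I" "f \<in> carrier (free_module (carrier (quotient_module I)))"
    using f by (auto simp: carrier_syzygy[OF I])
  then show "cover f \<in> I" and fin: "finite {X. f X \<noteq> 0}" by (simp_all add: free_module_simps)
  show "(\<lambda>x. f x * a) \<in> carrier (syzygy (quotient_module I))"
    using * fin by (simp add: carrier_syzygy[OF I] free_module_mult_closed cover_mult right_ideal_mult[OF I])
  assume g: "g \<in> carrier (syzygy (quotient_module I))"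
  then have "finite {X. g X \<noteq> 0}" by (simp add: carrier_syzygy[OF I] free_module_simps)
  then show "(\<lambda>x. f x + g x) \<in> carrier (syzygy (quotient_module I))"
    using * fin g by (auto simp: carrier_syzygy[OF I] free_module_add_closed cover_add intro!: right_ideal_add[OF I])
qed

lemma right_module_syzygy:
  assumes I: "right_ideal I" shows "right_module (syzygy (quotient_module I))"
proof (intro right_module.intro right_module_axioms.intro abelian_groupI)
  fix f assume "f \<in> carrier (syzygy (quotient_module I))"
  then have "(\<lambda>x. f x * (- 1)) \<in> carrier (syzygy (quotient_module I))" by (rule syzygy_mult_closed[OF I])
  then show "\<exists>g\<in>carrier (syzygy (quotient_module I)). g \<oplus>\<^bsub>syzygy (quotient_module I)\<^esub> f = \<zero>\<^bsub>syzygy (quotient_module I)\<^esub>"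
    by (rule bexI[rotated]) (simp add: syzygy_simps)
next
  show "\<zero>\<^bsub>syzygy (quotient_module I)\<^esub> \<in> carrier (syzygy (quotient_module I))"
    by (simp add: syzygy_simps carrier_syzygy[OF I] free_module_simps cover_def right_ideal_zero[OF I])
qed (auto simp: syzygy_mult_closed[OF I] syzygy_add_closed[OF I] syzygy_simps algebra_simps)

text \<open>The pullback along \<open>cover\<close> of the map \<open>I \<rightarrow> A/K\<close>
  represented by \<open>h\<close>.\<close>

definition syzygy_hom :: "'a set \<Rightarrow> 'a set \<Rightarrow> ('a \<Rightarrow> 'a) \<Rightarrow> ('a set \<Rightarrow> 'a) \<Rightarrow> 'a set" where
  "syzygy_hom I K h = (\<lambda>f\<in>carrier (syzygy (quotient_module I)). coset K (h (cover f)))"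

abbreviation syzygy_hom_space ::
  "'a set \<Rightarrow> 'a set \<Rightarrow> ('k, ('a set \<Rightarrow> 'a) \<Rightarrow> 'a set) module" where
  "syzygy_hom_space I K \<equiv> hom_space scale (syzygy (quotient_module I)) (quotient_module K)"

abbreviation extendable ::
  "'a set \<Rightarrow> 'a set \<Rightarrow> (('a set \<Rightarrow> 'a) \<Rightarrow> 'a set) set" where
  "extendable I K \<equiv> (\<lambda>f. restrict f (carrier (syzygy (quotient_module I)))) `
     carrier (hom_space scale (free_module (carrier (quotient_module I))) (quotient_module K))"

lemma syzygy_hom_carrier:
  assumes I: "right_ideal I" and K: "right_ideal K"
    and add: "\<And>x y. h (x + y) = h x + h y"
    and mult: "\<And>x a. x \<in> I \<Longrightarrow> h (x * a) - h x * a \<in> K"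
  shows "syzygy_hom I K h \<in> carrier (syzygy_hom_space I K)"
proof -
  have "(\<lambda>f. coset K (h (cover f))) \<in> homs (syzygy (quotient_module I)) (quotient_module K)"
  proof (rule homsI)
    show "coset K (h (cover f)) \<in> carrier (quotient_module K)" for f
      by (simp add: carrier_quotient_module[OF K])
  next
    fix f g assume "f \<in> carrier (syzygy (quotient_module I))" "g \<in> carrier (syzygy (quotient_module I))"
    then have "cover (f \<oplus>\<^bsub>syzygy (quotient_module I)\<^esub> g) = cover f + cover g"
      unfolding syzygy_simps by (intro cover_add syzygy_finite[OF I])
    then show "coset K (h (cover (f \<oplus>\<^bsub>syzygy (quotient_module I)\<^esub> g))) =
        coset K (h (cover f)) \<oplus>\<^bsub>quotient_module K\<^esub> coset K (h (cover g))"
      by (simp add: add add_quotient_module[OF K])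
  next
    fix a f assume f: "f \<in> carrier (syzygy (quotient_module I))"
    then have "cover (a \<odot>\<^bsub>syzygy (quotient_module I)\<^esub> f) = cover f * a"
      unfolding syzygy_simps by (intro cover_mult syzygy_finite[OF I])
    then show "coset K (h (cover (a \<odot>\<^bsub>syzygy (quotient_module I)\<^esub> f))) =
        a \<odot>\<^bsub>quotient_module K\<^esub> coset K (h (cover f))"
      using mult[OF syzygy_cover[OF I f]] by (simp add: smult_quotient_module[OF K] coset_eq_iff[OF K])
  qed
  then show ?thesis
    unfolding hom_space_simps Int_iff syzygy_hom_def restrict_homs[OF right_module_syzygy[OF I]] by simp
qed

text \<open>A homomorphism on \<open>A\<close> is a left multiplication, so a homomorphism on the syzygy that extends
  to the free module comes from a left multiplication on \<open>I\<close>.\<close>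

lemma syzygy_hom_extendable:
  assumes I: "right_ideal I" and K: "right_ideal K" and h: "syzygy_hom I K h \<in> extendable I K"
  shows "\<exists>t. \<forall>y\<in>I. h y - t * y \<in> K"
proof -
  let ?S = "syzygy (quotient_module I)" and ?F = "free_module (carrier (quotient_module I))"
  obtain G where G: "G \<in> homs ?F (quotient_module K)"
    and eq: "syzygy_hom I K h = restrict G (carrier ?S)"
    using h by (auto simp: hom_space_simps)
  \<comment> \<open>The copy of \<open>A\<close> at the free generator \<open>coset I 1\<close>. It
    is a section of \<open>cover\<close> because the representative of that coset is exactly
    \<open>1\<close>.\<close>
  define \<delta> where "\<delta> y = (\<lambda>X. if X = coset I 1 then y else 0)" for y :: 'a
  have supp: "{X. \<delta> y X \<noteq> 0} \<subseteq> {coset I 1}" for y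
    by (auto simp: \<delta>_def)
  have F: "\<delta> y \<in> carrier ?F" for y
    using supp[of y] by (auto simp: free_module_simps carrier_quotient_module[OF I] intro: finite_subset)
  have cover: "cover (\<delta> y) = y" for y
    by (subst cover_superset[OF _ supp]) (simp_all add: rep_coset_one[OF I], simp add: \<delta>_def)
  obtain t where t: "G (\<delta> 1) = coset K t"
    using homs_closed[OF G F[of 1]] by (auto simp: carrier_quotient_module[OF K])
  have "h y - t * y \<in> K" if y: "y \<in> I" for y
  proof -
    have "\<delta> y = y \<odot>\<^bsub>?F\<^esub> \<delta> 1" by (auto simp: \<delta>_def free_module_simps)
    then have "G (\<delta> y) = coset K (t * y)"
      using homs_smult[OF G F[of 1], of y] by (simp add: t smult_quotient_module[OF K])
    moreover have "\<delta> y \<in> carrier ?S"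
      using F y cover by (simp add: carrier_syzygy[OF I])
    then have "G (\<delta> y) = coset K (h y)"
      using fun_cong[OF eq, of "\<delta> y"] by (simp add: syzygy_hom_def cover)
    ultimately show ?thesis by (simp add: coset_eq_iff[OF K])
  qed
  then show ?thesis by blast
qed

lemma vector_quotient_extendable:
  assumes I: "right_ideal I" and K: "right_ideal K"
  shows "vector_quotient (syzygy_hom_space I K) (extendable I K)"
proof -
  let ?S = "syzygy (quotient_module I)" and ?F = "free_module (carrier (quotient_module I))"
  let ?Q = "quotient_module K"
  note mS = right_module_syzygy[OF I] and mF = right_module_free_module
    and mQ = right_module_quotient_module[OF K]
  interpret V: vectorspace class_ring "hom_space scale ?S ?Q" by (rule vectorspace_hom_space[OF mS mQ])
  interpret F: vectorspace class_ring "hom_space scale ?F ?Q" by (rule vectorspace_hom_space[OF mF mQ])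
  have sub: "carrier ?S \<subseteq> carrier ?F" by (auto simp: carrier_syzygy[OF I])
  have res: "restrict f (carrier ?S) \<in> carrier (hom_space scale ?S ?Q)" if f: "f \<in> homs ?F ?Q" for f
  proof -
    have "f \<in> homs ?S ?Q"
    proof (rule homsI)
      fix x y assume "x \<in> carrier ?S" "y \<in> carrier ?S"
      then show "f (x \<oplus>\<^bsub>?S\<^esub> y) = f x \<oplus>\<^bsub>?Q\<^esub> f y"
        using homs_add[OF f, of x y] sub unfolding syzygy_simps free_module_simps(3) by blast
    next
      fix a x assume "x \<in> carrier ?S"
      then show "f (a \<odot>\<^bsub>?S\<^esub> x) = a \<odot>\<^bsub>?Q\<^esub> f x"
        using homs_smult[OF f, of x a] sub unfolding syzygy_simps free_module_simps(4) by blast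
    qed (use homs_closed[OF f] sub in blast)
    then show ?thesis
      unfolding hom_space_simps Int_iff restrict_homs[OF mS] by simp
  qed
  have "submodule class_ring (extendable I K) (hom_space scale ?S ?Q)"
  proof (rule submodule.intro)
    show "module class_ring (hom_space scale ?S ?Q)" by (rule V.module_axioms)
    show "extendable I K \<subseteq> carrier (hom_space scale ?S ?Q)"
      using res by (auto simp: hom_space_simps(1)[of _ ?F])
    show "\<zero>\<^bsub>hom_space scale ?S ?Q\<^esub> \<in> extendable I K"
      using sub by (intro image_eqI[OF _ F.zero_closed]) (auto simp: hom_space_simps fun_eq_iff)
  next
    fix v w assume "v \<in> extendable I K" "w \<in> extendable I K"
    then obtain f g where fg: "f \<in> carrier (hom_space scale ?F ?Q)" "g \<in> carrier (hom_space scale ?F ?Q)"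
      "v = restrict f (carrier ?S)" "w = restrict g (carrier ?S)" by blast
    then show "v \<oplus>\<^bsub>hom_space scale ?S ?Q\<^esub> w \<in> extendable I K"
      using sub by (intro image_eqI[OF _ F.add.m_closed[OF fg(1,2)]]) (auto simp: hom_space_simps fun_eq_iff)
  next
    fix c :: 'k and v assume "v \<in> extendable I K"
    then obtain f where f: "f \<in> carrier (hom_space scale ?F ?Q)" "v = restrict f (carrier ?S)" by blast
    then show "c \<odot>\<^bsub>hom_space scale ?S ?Q\<^esub> v \<in> extendable I K"
      using sub by (intro image_eqI[OF _ F.smult_closed[of c, OF _ f(1)]]) (auto simp: hom_space_simps fun_eq_iff)
  qed
  then show ?thesis
    by (intro vector_quotient.intro vector_quotient_axioms.intro VectorSpace.subspace.intro V.vectorspace_axioms)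
qed

text \<open>The class of the pulled back homomorphism is zero, so it extends to the free module and
  comes from a left multiplication.\<close>

lemma Ext1_dim_zero:
  assumes I: "right_ideal I" and K: "right_ideal K"
    and fd: "vectorspace.fin_dim class_ring (Ext1 scale (quotient_module I) (quotient_module K))"
    and dim: "vectorspace.dim class_ring (Ext1 scale (quotient_module I) (quotient_module K)) = 0"
    and add: "\<And>x y. h (x + y) = h x + h y"
    and mult: "\<And>x a. x \<in> I \<Longrightarrow> h (x * a) - h x * a \<in> K"
  shows "\<exists>t. \<forall>y\<in>I. h y - t * y \<in> K"
proof -
  interpret E: vector_quotient "syzygy_hom_space I K" "extendable I K"
    by (rule vector_quotient_extendable[OF I K])
  note hc = syzygy_hom_carrier[OF I K add mult]
  have "extendable I K +>\<^bsub>syzygy_hom_space I K\<^esub> syzygy_hom I K h = \<zero>\<^bsub>E.quotient\<^esub>"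
    by (rule vectorspace_dim_zero[OF E.vectorspace_quotient fd[unfolded Ext1_def] dim[unfolded Ext1_def]])
      (use hc E.carrier_quotient in blast)
  then have "syzygy_hom I K h \<in> extendable I K"
    using E.coset_eq_zero_iff[OF hc] E.zero_quotient by simp
  then show ?thesis by (rule syzygy_hom_extendable[OF I K])
qed

lemma Ext1_dim_le_one:
  assumes I: "right_ideal I" and K: "right_ideal K"
    and fd: "vectorspace.fin_dim class_ring (Ext1 scale (quotient_module I) (quotient_module K))"
    and dim: "vectorspace.dim class_ring (Ext1 scale (quotient_module I) (quotient_module K)) \<le> 1"
    and add: "\<And>x y. h (x + y) = h x + h y" "\<And>x y. h' (x + y) = h' x + h' y"
    and mult: "\<And>x a. x \<in> I \<Longrightarrow> h (x * a) - h x * a \<in> K" "\<And>x a. x \<in> I \<Longrightarrow> h' (x * a) - h' x * a \<in> K"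
  shows "\<exists>c d t. (c \<noteq> 0 \<or> d \<noteq> 0) \<and> (\<forall>y\<in>I. scale c (h y) + scale d (h' y) - t * y \<in> K)"
proof -
  interpret E: vector_quotient "syzygy_hom_space I K" "extendable I K"
    by (rule vector_quotient_extendable[OF I K])
  let ?g = "syzygy_hom I K h" and ?g' = "syzygy_hom I K h'"
  let ?V = "syzygy_hom_space I K" and ?W = "extendable I K"
  note hc = syzygy_hom_carrier[OF I K add(1) mult(1)] syzygy_hom_carrier[OF I K add(2) mult(2)]
  obtain c d where cd: "c \<noteq> 0 \<or> d \<noteq> 0" and
    eq: "c \<odot>\<^bsub>E.quotient\<^esub> (?W +>\<^bsub>?V\<^esub> ?g) \<oplus>\<^bsub>E.quotient\<^esub> d \<odot>\<^bsub>E.quotient\<^esub> (?W +>\<^bsub>?V\<^esub> ?g') = \<zero>\<^bsub>E.quotient\<^esub>"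
    using vectorspace_dim_le_one[OF E.vectorspace_quotient fd[unfolded Ext1_def] dim[unfolded Ext1_def],
        of "?W +>\<^bsub>?V\<^esub> ?g" "?W +>\<^bsub>?V\<^esub> ?g'"] hc E.carrier_quotient by blast
  have "?W +>\<^bsub>?V\<^esub> (c \<odot>\<^bsub>?V\<^esub> ?g \<oplus>\<^bsub>?V\<^esub> d \<odot>\<^bsub>?V\<^esub> ?g') = ?W"
    using eq hc by (simp add: E.smult_quotient E.add_quotient E.zero_quotient)
  then have "c \<odot>\<^bsub>?V\<^esub> ?g \<oplus>\<^bsub>?V\<^esub> d \<odot>\<^bsub>?V\<^esub> ?g' \<in> ?W"
    using E.coset_eq_zero_iff hc by simp
  \<comment> \<open>The pullback is linear in \<open>h\<close>, so a relation between Ext classes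
    becomes a statement about one combined homomorphism.\<close>
  moreover have "c \<odot>\<^bsub>?V\<^esub> ?g \<oplus>\<^bsub>?V\<^esub> d \<odot>\<^bsub>?V\<^esub> ?g' = syzygy_hom I K (\<lambda>y. scale c (h y) + scale d (h' y))"
    by (auto simp: hom_space_simps syzygy_hom_def quotient_module_simps[OF K] fun_eq_iff
      scale_eq_mult[of _ "h _"] scale_eq_mult[of _ "h' _"])
  ultimately have "syzygy_hom I K (\<lambda>y. scale c (h y) + scale d (h' y)) \<in> ?W" by simp
  from syzygy_hom_extendable[OF I K this] cd show ?thesis by blast
qed

end

lemma (in fin_dim_algebra_alg_closed) simple_frame_ext_ex:
  assumes "\<And>S :: ('a, 'a set) module. simple_module S \<Longrightarrow>
      vectorspace.fin_dim class_ring (Ext1 scale S S) \<and>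
      vectorspace.dim class_ring (Ext1 scale S S) = 0"
    and "\<And>(S :: ('a, 'a set) module) (T :: ('a, 'a set) module). simple_module S \<Longrightarrow> simple_module T \<Longrightarrow>
      \<not> module_isomorphic S T \<Longrightarrow>
      vectorspace.fin_dim class_ring (Ext1 scale S T) \<and>
      vectorspace.dim class_ring (Ext1 scale S T) \<le> 1"
  shows "\<exists>R B unit. simple_frame_ext scale R B unit"
proof -
  obtain R B unit where "simple_frame scale R B unit"
    using simple_frame_ex by blast
  then interpret simple_frame scale R B unit .
  have "simple_frame_ext scale R B unit"
  proof unfold_locales
    fix I and h :: "'a \<Rightarrow> 'a"
    assume I: "I \<in> R" and h: "\<And>x y. h (x + y) = h x + h y" "\<And>x a. x \<in> I \<Longrightarrow> h (x * a) - h x * a \<in> I"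
    show "\<exists>t. \<forall>y\<in>I. h y - t * y \<in> I"
      using assms(1)[OF simple_quotient_module[OF maximal_R[OF I]]] h
      by (intro Ext1_dim_zero[OF right_ideal_R[OF I] right_ideal_R[OF I]]) auto
  next
    fix I K and h h' :: "'a \<Rightarrow> 'a"
    assume I: "I \<in> R" and K: "K \<in> R" and "I \<noteq> K"
      and h: "\<And>x y. h (x + y) = h x + h y" "\<And>x y. h' (x + y) = h' x + h' y"
        "\<And>x a. x \<in> I \<Longrightarrow> h (x * a) - h x * a \<in> K" "\<And>x a. x \<in> I \<Longrightarrow> h' (x * a) - h' x * a \<in> K"
    have "\<not> module_isomorphic (quotient_module I) (quotient_module K)"
      by (rule not_isomorphic_quotient_module[OF maximal_R[OF I] right_ideal_R[OF K] hom_trivial_R[OF I K \<open>I \<noteq> K\<close>]])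
    then show "\<exists>c d t. (c \<noteq> 0 \<or> d \<noteq> 0) \<and> (\<forall>y\<in>I. scale c (h y) + scale d (h' y) - t * y \<in> K)"
      using assms(2)[OF simple_quotient_module[OF maximal_R[OF I]] simple_quotient_module[OF maximal_R[OF K]]] h
      by (intro Ext1_dim_le_one[OF right_ideal_R[OF I] right_ideal_R[OF K]]) auto
  qed
  then show ?thesis by blast
qed

section \<open>The Lie algebra of outer derivations\<close>

text \<open>Needed because a Lie algebra record and its underlying module record have different
  types.\<close>

lemma vectorspace_cong:
  fixes V :: "('k::field, 'v, 'x) module_scheme" and V' :: "('k, 'v, 'y) module_scheme"
  assumes vs: "vectorspace class_ring V"
    and eq: "carrier V' = carrier V" "\<zero>\<^bsub>V'\<^esub> = \<zero>\<^bsub>V\<^esub>"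
      "\<And>x y. x \<oplus>\<^bsub>V'\<^esub> y = x \<oplus>\<^bsub>V\<^esub> y" "\<And>c x. c \<odot>\<^bsub>V'\<^esub> x = c \<odot>\<^bsub>V\<^esub> x"
  shows "vectorspace class_ring V'"
proof -
  interpret V: vectorspace class_ring V by (rule vs)
  have smult: "(a + b) \<odot>\<^bsub>V\<^esub> x = a \<odot>\<^bsub>V\<^esub> x \<oplus>\<^bsub>V\<^esub> b \<odot>\<^bsub>V\<^esub> x" "(a * b) \<odot>\<^bsub>V\<^esub> x = a \<odot>\<^bsub>V\<^esub> (b \<odot>\<^bsub>V\<^esub> x)"
    "1 \<odot>\<^bsub>V\<^esub> x = x" "a \<odot>\<^bsub>V\<^esub> x \<in> carrier V" if "x \<in> carrier V" for a b x
    using that V.smult_l_distr[of a b x] V.smult_assoc1[of a b x] V.smult_one[of x] V.smult_closed[of a x]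
    by simp_all
  show ?thesis
  proof (rule vs_criteria[OF class_field])
    show "\<forall>v\<in>carrier V'. \<exists>w\<in>carrier V'. v \<oplus>\<^bsub>V'\<^esub> w = \<zero>\<^bsub>V'\<^esub>"
      using V.a_inv_closed V.r_neg unfolding eq by blast
    show "\<forall>v w. v \<in> carrier V' \<and> w \<in> carrier V' \<longrightarrow> v \<oplus>\<^bsub>V'\<^esub> w = w \<oplus>\<^bsub>V'\<^esub> v"
      unfolding eq using V.a_comm by blast
  qed (auto simp: eq V.a_assoc smult V.smult_r_distr)
qed

section \<open>Lie products and filtrations\<close>

context lie_algebra
begin

lemma lie_product_subset:
  assumes "submodule class_ring N L" "\<And>u v. u \<in> U \<Longrightarrow> v \<in> V \<Longrightarrow> bracket L u v \<in> N"
  shows "lie_product L U V \<subseteq> N"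
  unfolding lie_product_def using assms by (intro span_is_subset) auto

lemma submodule_lie_product:
  assumes "U \<subseteq> carrier L" "V \<subseteq> carrier L" shows "submodule class_ring (lie_product L U V) L"
  unfolding lie_product_def using assms bracket_closed by (intro span_is_submodule) auto

lemma lie_product_mono:
  assumes "U \<subseteq> U'" "V \<subseteq> V'" shows "lie_product L U V \<subseteq> lie_product L U' V'"
  unfolding lie_product_def using assms by (intro span_is_monotone) blast

lemma submodule_derived: "submodule class_ring (lie_product L (carrier L) (carrier L)) L"
  by (intro submodule_lie_product) auto

text \<open>Spans depend on the ambient structure; all brackets lie in the derived subalgebra, where
  the span is the same as in \<open>L\<close>.\<close>

lemma lie_product_derived_subalgebra:
  assumes "U \<subseteq> carrier (derived_subalgebra L)" "V \<subseteq> carrier (derived_subalgebra L)"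
  shows "lie_product (derived_subalgebra L) U V = lie_product L U V"
proof -
  let ?D = "lie_product L (carrier L) (carrier L)"
  have D: "?D \<subseteq> carrier L"
    by (intro lie_product_subset bracket_closed) (auto intro: submodule.intro module_axioms)
  have "U \<subseteq> carrier L" "V \<subseteq> carrier L"
    using assms D by (simp_all add: derived_subalgebra_def)
  then have "{bracket L u v | u v. u \<in> U \<and> v \<in> V} \<subseteq> {bracket L u v | u v. u \<in> carrier L \<and> v \<in> carrier L}"
    by blast
  also have "\<dots> \<subseteq> ?D"
    unfolding lie_product_def using bracket_closed by (intro in_own_span) auto
  finally show ?thesis
    using span_li_not_depend(1)[OF _ submodule_derived]
    by (simp add: lie_product_def[of "derived_subalgebra L"] lie_product_def[of L U V])
      (simp add: derived_subalgebra_def)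
qed

text \<open>Brackets add degrees and the derived subalgebra lies in degree 1, so each further
  bracket with it raises the degree until the filtration ends at \<open>n\<close>.\<close>

lemma strongly_solvable_filtration:
  fixes F :: "nat \<Rightarrow> 'l set"
  assumes sub: "\<And>k. submodule class_ring (F k) L"
    and bracket: "\<And>k l x y. x \<in> F k \<Longrightarrow> y \<in> F l \<Longrightarrow> bracket L x y \<in> F (k + l)"
    and derived: "\<And>x y. x \<in> carrier L \<Longrightarrow> y \<in> carrier L \<Longrightarrow> bracket L x y \<in> F 1"
    and antimono: "\<And>k l. k \<le> l \<Longrightarrow> F l \<subseteq> F k"
    and trivial: "F n \<subseteq> {\<zero>}"
  shows "strongly_solvable_lie L" and "solvable_lie L"
proof -
  let ?D = "derived_subalgebra L"
  have F_carrier: "F k \<subseteq> carrier L" for k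
    using sub by (rule submodule.subset)
  have D1: "carrier ?D \<subseteq> F 1"
    unfolding derived_subalgebra_def using sub derived by (simp add: lie_product_subset)
  have D: "carrier ?D \<subseteq> carrier L"
    using D1 F_carrier by blast
  have product_subset: "lie_product L U V \<subseteq> carrier ?D" if "U \<subseteq> carrier L" "V \<subseteq> carrier L" for U V
    using lie_product_mono[OF that] by (simp add: derived_subalgebra_def)
  \<comment> \<open>The shift arises because the series starts at index 0 with the derived
    subalgebra, already inside \<open>F 1\<close>. The carrier inclusion makes the spans comparable;
    \<open>\<zero>\<close> is recorded because nilpotency asks for equality with
    \<open>{\<zero>}\<close>.\<close>
  have central: "lower_central ?D k \<subseteq> carrier ?D \<and> lower_central ?D k \<subseteq> F (Suc k) \<and> \<zero> \<in> lower_central ?D k" for k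
  proof (induction k)
    case 0
    show ?case using D1 submodule.zero_closed[OF submodule_derived] by (simp add: derived_subalgebra_def)
  next
    case (Suc k)
    have eq: "lower_central ?D (Suc k) = lie_product L (carrier ?D) (lower_central ?D k)"
      using Suc.IH by (simp add: lie_product_derived_subalgebra)
    have "lie_product L (carrier ?D) (lower_central ?D k) \<subseteq> F (1 + Suc k)"
      using Suc.IH D1 by (intro lie_product_subset sub bracket) auto
    moreover have "lie_product L (carrier ?D) (lower_central ?D k) \<subseteq> carrier ?D"
      using Suc.IH D by (intro product_subset) auto
    moreover have "submodule class_ring (lie_product L (carrier ?D) (lower_central ?D k)) L"
      using Suc.IH D by (intro submodule_lie_product) auto
    ultimately show ?case
      unfolding eq using submodule.zero_closed by auto
  qed
  have "lower_central ?D n \<subseteq> {\<zero>}"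
    using central[of n] antimono[of n "Suc n"] trivial by auto
  then have "lower_central ?D n = {\<zero>\<^bsub>?D\<^esub>}"
    using central[of n] by (auto simp: derived_subalgebra_def)
  then show "strongly_solvable_lie L"
    unfolding strongly_solvable_lie_def nilpotent_lie_def by blast
  \<comment> \<open>The induction starts at index 1, as \<open>F 0\<close> is not assumed to contain
    all of \<open>L\<close>.\<close>
  have series: "derived_series L (Suc k) \<subseteq> F (Suc k) \<and> \<zero> \<in> derived_series L (Suc k)" for k
  proof (induction k)
    case 0
    show ?case
      using lie_product_subset[OF sub derived] submodule.zero_closed[OF submodule_derived] by simp
  next
    case (Suc k)
    have "lie_product L (derived_series L (Suc k)) (derived_series L (Suc k)) \<subseteq> F (Suc k + Suc k)"
      using Suc.IH by (intro lie_product_subset sub bracket) auto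
    moreover have "F (Suc k + Suc k) \<subseteq> F (Suc (Suc k))"
      by (rule antimono) simp
    moreover have "submodule class_ring (lie_product L (derived_series L (Suc k)) (derived_series L (Suc k))) L"
      using Suc.IH F_carrier by (intro submodule_lie_product) blast+
    ultimately show ?case
      unfolding derived_series.simps(2)[of L "Suc k"] using submodule.zero_closed by blast
  qed
  have "derived_series L (Suc n) = {\<zero>}"
    using series[of n] antimono[of n "Suc n"] trivial by auto
  then show "solvable_lie L"
    unfolding solvable_lie_def by blast
qed

end

section \<open>Quotients by Lie ideals\<close>

locale lie_ideal_quotient = lie_algebra L + vector_quotient L W
  for L :: "('k::field, 'l) lie" (structure) and W +
  assumes ideal_left: "w \<in> W \<Longrightarrow> x \<in> carrier L \<Longrightarrow> bracket L w x \<in> W"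
    and ideal_right: "x \<in> carrier L \<Longrightarrow> w \<in> W \<Longrightarrow> bracket L x w \<in> W"
begin

abbreviation lie_quotient :: "('k, 'l set) lie" where
  "lie_quotient \<equiv> quotient_lie L W"

lemma
  shows carrier_lie_quotient: "carrier lie_quotient = (\<lambda>x. W +> x) ` carrier L"
    and zero_lie_quotient: "\<zero>\<^bsub>lie_quotient\<^esub> = W"
    and add_lie_quotient: "x \<in> carrier L \<Longrightarrow> y \<in> carrier L \<Longrightarrow> (W +> x) \<oplus>\<^bsub>lie_quotient\<^esub> (W +> y) = W +> (x \<oplus> y)"
    and smult_lie_quotient: "x \<in> carrier L \<Longrightarrow> c \<odot>\<^bsub>lie_quotient\<^esub> (W +> x) = W +> (c \<odot> x)"
  using quotient_simps by (simp_all add: quotient_lie_def Let_def)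

lemma vectorspace_lie_quotient: "vectorspace class_ring lie_quotient"
  by (rule vectorspace_cong[OF vectorspace_quotient]) (simp_all add: quotient_lie_def Let_def)

lemma bracket_lie_quotient:
  assumes x: "x \<in> carrier L" and y: "y \<in> carrier L"
  shows "bracket lie_quotient (W +> x) (W +> y) = W +> bracket L x y"
proof -
  have *: "W +> bracket L x' y' = W +> bracket L x y" if "x' \<in> W +> x" "y' \<in> W +> y" for x' y'
  proof -
    have "\<exists>w\<in>W. x' = w \<oplus> x" "\<exists>w\<in>W. y' = w \<oplus> y"
      using that by (simp_all only: coset_mem)
    then obtain w v where w: "w \<in> W" "x' = w \<oplus> x" and v: "v \<in> W" "y' = v \<oplus> y" by blast
    have cl: "w \<in> carrier L" "v \<in> carrier L" using w v W_subset by blast+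
    have "bracket L x' y' = (bracket L w (v \<oplus> y) \<oplus> bracket L x v) \<oplus> bracket L x y"
      using cl x y by (simp add: w v bracket_add_left bracket_add_right bracket_closed a_ac)
    moreover have "bracket L w (v \<oplus> y) \<oplus> bracket L x v \<in> W"
      using w v cl x y by (intro W_add ideal_left ideal_right) auto
    ultimately have "bracket L x' y' \<in> W +> bracket L x y"
      unfolding coset_mem by blast
    then show ?thesis
      using a_repr_independence' bracket_closed[OF x y] by simp
  qed
  have "bracket lie_quotient (W +> x) (W +> y) = (\<Union>x'\<in>W +> x. \<Union>y'\<in>W +> y. W +> bracket L x' y')"
    by (simp add: quotient_lie_def Let_def)
  also have "\<dots> = (\<Union>x'\<in>W +> x. \<Union>y'\<in>W +> y. W +> bracket L x y)"
    by (intro SUP_cong refl *)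
  also have "\<dots> = W +> bracket L x y"
    using a_rcos_self[OF x] a_rcos_self[OF y] by blast
  finally show ?thesis .
qed

lemma lie_algebra_lie_quotient: "lie_algebra lie_quotient"
proof (intro lie_algebra.intro vectorspace_lie_quotient lie_algebra_axioms.intro)
  have zero: "\<zero>\<^bsub>lie_quotient\<^esub> = W +> \<zero>"
    using coset_eq_zero_iff[of \<zero>] W_zero by (simp add: zero_lie_quotient)
  fix X assume "X \<in> carrier lie_quotient"
  then obtain x where x: "X = W +> x" "x \<in> carrier L" unfolding carrier_lie_quotient by blast
  show "bracket lie_quotient X X = \<zero>\<^bsub>lie_quotient\<^esub>"
    using x by (simp add: bracket_lie_quotient bracket_self zero)
  fix Y assume "Y \<in> carrier lie_quotient"
  then obtain y where y: "Y = W +> y" "y \<in> carrier L" unfolding carrier_lie_quotient by blast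
  note simps = bracket_lie_quotient add_lie_quotient smult_lie_quotient bracket_closed
  show "bracket lie_quotient X Y \<in> carrier lie_quotient"
    using x y by (simp add: simps carrier_lie_quotient)
  show "bracket lie_quotient (c \<odot>\<^bsub>lie_quotient\<^esub> X) Y = c \<odot>\<^bsub>lie_quotient\<^esub> bracket lie_quotient X Y" for c
    using x y smult_rules(4)[of x] by (simp add: simps bracket_smult_left)
  show "bracket lie_quotient X (c \<odot>\<^bsub>lie_quotient\<^esub> Y) = c \<odot>\<^bsub>lie_quotient\<^esub> bracket lie_quotient X Y" for c
    using x y smult_rules(4)[of y] by (simp add: simps bracket_smult_right)
  fix Z assume "Z \<in> carrier lie_quotient"
  then obtain z where z: "Z = W +> z" "z \<in> carrier L" unfolding carrier_lie_quotient by blast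
  show "bracket lie_quotient (X \<oplus>\<^bsub>lie_quotient\<^esub> Y) Z =
      bracket lie_quotient X Z \<oplus>\<^bsub>lie_quotient\<^esub> bracket lie_quotient Y Z"
    using x y z by (simp add: simps bracket_add_left)
  show "bracket lie_quotient X (Y \<oplus>\<^bsub>lie_quotient\<^esub> Z) =
      bracket lie_quotient X Y \<oplus>\<^bsub>lie_quotient\<^esub> bracket lie_quotient X Z"
    using x y z by (simp add: simps bracket_add_right)
  show "bracket lie_quotient X (bracket lie_quotient Y Z) \<oplus>\<^bsub>lie_quotient\<^esub>
      bracket lie_quotient Y (bracket lie_quotient Z X) \<oplus>\<^bsub>lie_quotient\<^esub>
      bracket lie_quotient Z (bracket lie_quotient X Y) = \<zero>\<^bsub>lie_quotient\<^esub>"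
    using x y z by (simp add: simps jacobi zero)
qed

lemma submodule_image:
  assumes U: "submodule class_ring U L"
  shows "submodule class_ring ((\<lambda>x. W +> x) ` U) lie_quotient"
proof (rule submodule.intro)
  interpret Q: vectorspace class_ring lie_quotient by (rule vectorspace_lie_quotient)
  show "module class_ring lie_quotient" by (rule Q.module_axioms)
  have sub: "U \<subseteq> carrier L" by (rule submodule.subset[OF U])
  then show "(\<lambda>x. W +> x) ` U \<subseteq> carrier lie_quotient" by (auto simp: carrier_lie_quotient)
  show "\<zero>\<^bsub>lie_quotient\<^esub> \<in> (\<lambda>x. W +> x) ` U"
    using submodule.zero_closed[OF U] coset_eq_zero_iff[of \<zero>] W_zero
    by (intro image_eqI[of _ _ \<zero>]) (auto simp: zero_lie_quotient)
  show "X \<oplus>\<^bsub>lie_quotient\<^esub> Y \<in> (\<lambda>x. W +> x) ` U" if XY: "X \<in> (\<lambda>x. W +> x) ` U" "Y \<in> (\<lambda>x. W +> x) ` U" for X Y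
  proof -
    obtain x y where "X = W +> x" "Y = W +> y" "x \<in> U" "y \<in> U" using XY by blast
    then show ?thesis
      using sub submodule.m_closed[OF U, of x y] by (simp add: add_lie_quotient subset_iff)
  qed
  show "c \<odot>\<^bsub>lie_quotient\<^esub> X \<in> (\<lambda>x. W +> x) ` U" if X: "X \<in> (\<lambda>x. W +> x) ` U" for c X
  proof -
    obtain x where "X = W +> x" "x \<in> U" using X by blast
    then show ?thesis
      using sub submodule.smult_closed[OF U, of c x] by (simp add: smult_lie_quotient subset_iff)
  qed
qed

end

section \<open>Derivations as a Lie algebra and the filtration of \<open>HH1\<close>\<close>

context fin_dim_algebra
begin

lemma Der_simps:
  "carrier (Der scale) = derivations scale" "\<zero>\<^bsub>Der scale\<^esub> = (\<lambda>x. 0)"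
  "D \<oplus>\<^bsub>Der scale\<^esub> E = (\<lambda>x. D x + E x)" "c \<odot>\<^bsub>Der scale\<^esub> D = (\<lambda>x. scale c (D x))"
  "bracket (Der scale) D E = (\<lambda>x. D (E x) - E (D x))"
  by (simp_all add: Der_def)

lemma derivation_add_mem:
  "D \<in> derivations scale \<Longrightarrow> E \<in> derivations scale \<Longrightarrow> (\<lambda>x. D x + E x) \<in> derivations scale"
  by (rule derivationI)
    (simp_all add: derivation_add derivation_scale derivation_mult scale_right_distrib algebra_simps)

lemma derivation_scale_mem:
  "D \<in> derivations scale \<Longrightarrow> (\<lambda>x. scale c (D x)) \<in> derivations scale"
  by (rule derivationI)
    (simp_all add: derivation_add derivation_scale derivation_mult scale_right_distrib mult.commute
      scale_left_commute flip: scale_mult_left scale_mult_right)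

lemma derivation_zero_mem: "(\<lambda>x. 0) \<in> derivations scale"
  by (rule derivationI) auto

lemma vectorspace_Der: "vectorspace class_ring (Der scale)"
proof (rule vs_criteria[OF class_field])
  show "\<forall>D\<in>carrier (Der scale). \<exists>E\<in>carrier (Der scale). D \<oplus>\<^bsub>Der scale\<^esub> E = \<zero>\<^bsub>Der scale\<^esub>"
  proof
    fix D assume "D \<in> carrier (Der scale)"
    then have "(\<lambda>x. scale (- 1) (D x)) \<in> carrier (Der scale)"
      unfolding Der_simps by (rule derivation_scale_mem)
    then show "\<exists>E\<in>carrier (Der scale). D \<oplus>\<^bsub>Der scale\<^esub> E = \<zero>\<^bsub>Der scale\<^esub>"
      by (rule bexI[rotated]) (simp add: Der_simps)
  qed
qed (auto simp: Der_simps derivation_zero_mem derivation_add_mem derivation_scale_mem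
    scale_left_distrib scale_right_distrib algebra_simps)

lemma lie_algebra_Der: "lie_algebra (Der scale)"
  by (intro lie_algebra.intro vectorspace_Der lie_algebra_axioms.intro)
    (auto simp: Der_simps derivation_bracket derivation_add derivation_diff derivation_scale
      scale_right_diff_distrib algebra_simps)

lemma submodule_DerI:
  assumes "U \<subseteq> derivations scale" "(\<lambda>x. 0) \<in> U"
    "\<And>D E. D \<in> U \<Longrightarrow> E \<in> U \<Longrightarrow> (\<lambda>x. D x + E x) \<in> U" "\<And>c D. D \<in> U \<Longrightarrow> (\<lambda>x. scale c (D x)) \<in> U"
  shows "submodule class_ring U (Der scale)"
proof -
  interpret D: vectorspace class_ring "Der scale" by (rule vectorspace_Der)
  show ?thesis
    using assms by (intro submodule.intro D.module_axioms) (auto simp: Der_simps)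
qed

lemma inner_derivationsI: "(\<And>x. D x = a * x - x * a) \<Longrightarrow> D \<in> inner_derivations"
  unfolding inner_derivations_def by auto

lemma submodule_inner_derivations: "submodule class_ring inner_derivations (Der scale)"
proof (rule submodule_DerI)
  show "inner_derivations \<subseteq> derivations scale"
    unfolding inner_derivations_def using inner_derivation by blast
  show "(\<lambda>x. 0) \<in> inner_derivations"
    by (rule inner_derivationsI[of _ 0]) simp
next
  fix D E :: "'a \<Rightarrow> 'a" assume "D \<in> inner_derivations" "E \<in> inner_derivations"
  then obtain a b where "D = (\<lambda>x. a * x - x * a)" "E = (\<lambda>x. b * x - x * b)"
    unfolding inner_derivations_def by blast
  then show "(\<lambda>x. D x + E x) \<in> inner_derivations"
    by (intro inner_derivationsI[of _ "a + b"]) (simp add: algebra_simps)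
next
  fix c and D :: "'a \<Rightarrow> 'a" assume "D \<in> inner_derivations"
  then obtain a where "D = (\<lambda>x. a * x - x * a)"
    unfolding inner_derivations_def by blast
  then show "(\<lambda>x. scale c (D x)) \<in> inner_derivations"
    by (intro inner_derivationsI[of _ "scale c a"])
      (simp add: scale_right_diff_distrib flip: scale_mult_left scale_mult_right)
qed

text \<open>The bracket of \<open>D\<close> with the inner derivation of \<open>a\<close> is the
  inner derivation of \<open>D a\<close>.\<close>

lemma lie_ideal_quotient_inner: "lie_ideal_quotient (Der scale) inner_derivations"
proof (intro lie_ideal_quotient.intro lie_algebra_Der vector_quotient.intro vectorspace_Der
    vector_quotient_axioms.intro VectorSpace.subspace.intro submodule_inner_derivations
    lie_ideal_quotient_axioms.intro)
  fix w D :: "'a \<Rightarrow> 'a" assume "w \<in> inner_derivations" and D: "D \<in> carrier (Der scale)"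
  then obtain a where w: "w = (\<lambda>x. a * x - x * a)"
    unfolding inner_derivations_def by blast
  from D have D: "D \<in> derivations scale" by (simp add: Der_simps)
  show "bracket (Der scale) w D \<in> inner_derivations"
    by (rule inner_derivationsI[of _ "- D a"])
      (simp add: Der_simps w derivation_diff[OF D] derivation_mult[OF D] algebra_simps)
  show "bracket (Der scale) D w \<in> inner_derivations"
    by (rule inner_derivationsI[of _ "D a"])
      (simp add: Der_simps w derivation_diff[OF D] derivation_mult[OF D] algebra_simps)
qed

lemma submodule_filtered_derivations: "submodule class_ring (filtered_derivations k) (Der scale)"
  by (rule submodule_DerI)
    (auto simp: filtered_derivations_def derivation_zero_mem derivation_add_mem derivation_scale_mem
      intro: subspace_0[OF subspace_radical_power] subspace_add[OF subspace_radical_power]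
        subspace_scale[OF subspace_radical_power])

end

text \<open>The images \<open>F k\<close> of \<open>filtered_derivations k\<close> form the required
  filtration: \<open>commutator_filtered\<close> puts every bracket into \<open>F 1\<close>, and
  nilpotency of \<open>J\<close> makes some \<open>F n\<close> trivial.\<close>

lemma (in simple_frame_ext) HH1_strongly_solvable:
  "lie_algebra (HH1 scale)" "strongly_solvable_lie (HH1 scale)" "solvable_lie (HH1 scale)"
proof -
  let ?L = "Der scale" and ?W = "inner_derivations :: ('a \<Rightarrow> 'a) set"
  interpret Q: lie_ideal_quotient ?L ?W by (rule lie_ideal_quotient_inner)
  show H: "lie_algebra (HH1 scale)"
    unfolding HH1_def by (rule Q.lie_algebra_lie_quotient)
  interpret H: lie_algebra "quotient_lie ?L ?W" by (rule Q.lie_algebra_lie_quotient)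
  define F where "F k = (\<lambda>D. ?W +>\<^bsub>?L\<^esub> D) ` filtered_derivations k" for k
  have carrier: "filtered_derivations k \<subseteq> carrier ?L" for k
    by (auto simp: filtered_derivations_def Der_simps)
  obtain n where n: "filtered_derivations n \<subseteq> {\<lambda>x. 0}"
    using filtered_derivations_trivial by blast
  have sub: "submodule class_ring (F k) (quotient_lie ?L ?W)" for k
    unfolding F_def by (intro Q.submodule_image submodule_filtered_derivations)
  have bracket: "bracket (quotient_lie ?L ?W) X Y \<in> F (k + l)" if "X \<in> F k" "Y \<in> F l" for k l X Y
  proof -
    obtain D E where DE: "X = ?W +>\<^bsub>?L\<^esub> D" "Y = ?W +>\<^bsub>?L\<^esub> E" "D \<in> filtered_derivations k" "E \<in> filtered_derivations l"
      using \<open>X \<in> F k\<close> \<open>Y \<in> F l\<close> unfolding F_def by blast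
    then have "bracket (quotient_lie ?L ?W) X Y = ?W +>\<^bsub>?L\<^esub> bracket ?L D E"
      using carrier by (simp add: Q.bracket_lie_quotient subset_iff)
    moreover have "bracket ?L D E \<in> filtered_derivations (k + l)"
      unfolding Der_simps by (rule filtered_derivations_bracket[OF DE(3,4)])
    ultimately show ?thesis unfolding F_def by blast
  qed
  have derived: "bracket (quotient_lie ?L ?W) X Y \<in> F 1"
    if XY: "X \<in> carrier (quotient_lie ?L ?W)" "Y \<in> carrier (quotient_lie ?L ?W)" for X Y
  proof -
    obtain D E where DE: "X = ?W +>\<^bsub>?L\<^esub> D" "Y = ?W +>\<^bsub>?L\<^esub> E" "D \<in> carrier ?L" "E \<in> carrier ?L"
      using XY unfolding Q.carrier_lie_quotient by blast
    obtain M a where M: "M \<in> filtered_derivations 1" "\<And>x. D (E x) - E (D x) = M x + (a * x - x * a)"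
      using commutator_filtered[of D E] DE(3,4) unfolding Der_simps by blast
    have "bracket ?L D E = (\<lambda>x. a * x - x * a) \<oplus>\<^bsub>?L\<^esub> M"
      unfolding Der_simps M(2) by (simp add: add.commute)
    then have "bracket ?L D E \<in> ?W +>\<^bsub>?L\<^esub> M"
      unfolding Q.coset_mem using inner_derivationsI[of "\<lambda>x. a * x - x * a" a] by blast
    then have "?W +>\<^bsub>?L\<^esub> M = ?W +>\<^bsub>?L\<^esub> bracket ?L D E"
      using M(1) carrier by (intro Q.a_repr_independence') auto
    then show ?thesis
      using DE M(1) unfolding F_def by (simp add: Q.bracket_lie_quotient) (metis image_eqI)
  qed
  have antimono: "F l \<subseteq> F k" if "k \<le> l" for k l
    unfolding F_def using filtered_derivations_antimono[OF that] by blast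
  have trivial: "F n \<subseteq> {\<zero>\<^bsub>quotient_lie ?L ?W\<^esub>}"
  proof -
    have "?W +>\<^bsub>?L\<^esub> (\<lambda>x. 0) = ?W"
      using Q.coset_eq_zero_iff[of "\<lambda>x. 0"] Q.W_zero by (simp add: Der_simps derivation_zero_mem)
    then show ?thesis
      using n unfolding F_def Q.zero_lie_quotient by auto
  qed
  show "strongly_solvable_lie (HH1 scale)" "solvable_lie (HH1 scale)"
    unfolding HH1_def by (rule H.strongly_solvable_filtration[of F, OF sub bracket derived antimono trivial]; assumption)+
qed

text \<open>\<open>fin_dim\<close> accompanies each bound because \<open>dim\<close> is meaningful
  only in finite dimension, and simple modules of this type suffice by
  \<open>simple_module_representative\<close>. The Lie algebra axioms are asserted as well, since
  the solvability predicates do not contain them.\<close>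

theorem theorem1p1:
  fixes scale :: "'k::alg_closed_field \<Rightarrow> 'a::{ring,monoid_mult} \<Rightarrow> 'a"
  assumes "fin_dim_algebra scale"
    and "\<And>S :: ('a, 'a set) module. simple_module S \<Longrightarrow>
      vectorspace.fin_dim class_ring (Ext1 scale S S) \<and>
      vectorspace.dim class_ring (Ext1 scale S S) = 0"
    and "\<And>(S :: ('a, 'a set) module) (T :: ('a, 'a set) module). simple_module S \<Longrightarrow> simple_module T \<Longrightarrow>
      \<not> module_isomorphic S T \<Longrightarrow>
      vectorspace.fin_dim class_ring (Ext1 scale S T) \<and>
      vectorspace.dim class_ring (Ext1 scale S T) \<le> 1"
  shows "lie_algebra (HH1 scale) \<and> strongly_solvable_lie (HH1 scale) \<and> solvable_lie (HH1 scale)"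
proof -
  interpret fin_dim_algebra_alg_closed scale
    by (rule fin_dim_algebra_alg_closed.intro) (rule assms(1))
  obtain R B unit where "simple_frame_ext scale R B unit"
    using simple_frame_ext_ex[OF assms(2,3)] by blast
  then show ?thesis
    using simple_frame_ext.HH1_strongly_solvable by blast
qed

end
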